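(* Let $X$ be a closed manifold of dimension at least $2$ or the Hilbert cube, and let $G$ be a locally transitive subgroup of $\mathrm{Homeo}(X)$. Then the universal minimal flow of $G$ is not metrizable.
   Context: A closed manifold is a compact, connected topological manifold without boundary. $\mathrm{Homeo}(X)$ is the group of all homeomorphisms of $X$ with the compact-open topology (equivalently, the topology of uniform convergence, given by the right-invariant metric $d_G(g,h)=\sup_{x\in X} d(gx,hx)$ for a compatible metric $d$ on $X$); a subgroup $G\le \mathrm{Homeo}(X)$ carries the subspace topology. For a subgroup $G\le \mathrm{Homeo}(X)$ and an open set $U\subseteq X$, the rigid stabilizer $G_U$ is the subgroup of all $g\in G$ that fix every point of $X\setminus U$. The subgroup $G$ is locally transitive if for every open $U\subseteq X$ and every $x\in U$, the set $G_U\cdot x$ contains a neighborhood of $x$. For a topological group $G$, a $G$-flow is a continuous action of $G$ on a compact Hausdorff space; it is minimal if all orbits are dense. The universal minimal flow of $G$ is the minimal $G$-flow (unique up to isomorphism) that admits every minimal $G$-flow as a factor, i.e. that maps onto every minimal $G$-flow by a continuous $G$-equivariant map. *)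

theory Defs
  imports "HOL-Analysis.Analysis" "HOL-Algebra.Group_Action"
begin

no_notation eq_closure_of (\<open>closure'_of\<index>\<close>) \<comment> \<open>clashes with topological closure\<close>

section \<open>The spaces\<close>

text \<open>Isabelle regards the empty space as connected, so nonemptiness is a separate clause;
  second countability would follow from the other clauses.\<close>

definition closed_manifold :: "nat \<Rightarrow> 'a topology \<Rightarrow> bool" where
  "closed_manifold n X \<longleftrightarrow>
     topspace X \<noteq> {} \<and> compact_space X \<and> connected_space X \<and>
     Hausdorff_space X \<and> second_countable X \<and>
     (\<forall>x\<in>topspace X. \<exists>U. openin X U \<and> x \<in> U \<and>
        subtopology X U homeomorphic_space Euclidean_space n)"

definition Hilbert_cube :: "(nat \<Rightarrow> real) topology" where
  "Hilbert_cube = product_topology (\<lambda>_. top_of_set {0..1}) UNIV"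


section \<open>Homeomorphism groups\<close>

text \<open>As in \<^const>\<open>BijGroup\<close>, homeomorphisms are normalised to be \<^const>\<open>undefined\<close> outside
  the space, so that equal homeomorphisms are equal functions.\<close>

definition Homeo :: "'a topology \<Rightarrow> ('a \<Rightarrow> 'a) monoid" where
  "Homeo X = BijGroup (topspace X)
     \<lparr>carrier := {g \<in> extensional (topspace X). homeomorphic_map X X g}\<rparr>"

definition compact_open_topology :: "'a topology \<Rightarrow> ('a \<Rightarrow> 'a) topology" where
  "compact_open_topology X = topology_generated_by
     {{g \<in> carrier (Homeo X). g ` K \<subseteq> U} | K U. compactin X K \<and> openin X U}"

definition rigid_stabilizer :: "'a topology \<Rightarrow> ('a \<Rightarrow> 'a) set \<Rightarrow> 'a set \<Rightarrow> ('a \<Rightarrow> 'a) set" where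
  "rigid_stabilizer X G U = {g \<in> G. \<forall>x \<in> topspace X - U. g x = x}"

definition locally_transitive :: "'a topology \<Rightarrow> ('a \<Rightarrow> 'a) set \<Rightarrow> bool" where
  "locally_transitive X G \<longleftrightarrow>
     (\<forall>U. openin X U \<longrightarrow> (\<forall>x\<in>U. \<exists>V. openin X V \<and> x \<in> V \<and>
        V \<subseteq> {g x | g. g \<in> rigid_stabilizer X G U}))"


section \<open>Flows\<close>

text \<open>Below, \<open>T\<close> is the topology of the topological group \<open>G\<close>, with
  \<open>topspace T = carrier G\<close>.\<close>

definition flow ::
  "('g, 'b) monoid_scheme \<Rightarrow> 'g topology \<Rightarrow> 'y topology \<Rightarrow> ('g \<Rightarrow> 'y \<Rightarrow> 'y) \<Rightarrow> bool" where
  "flow G T Y \<phi> \<longleftrightarrow>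
     compact_space Y \<and> Hausdorff_space Y \<and> group_action G (topspace Y) \<phi> \<and>
     continuous_map (prod_topology T Y) Y (\<lambda>(g, y). \<phi> g y)"

definition minimal_flow ::
  "('g, 'b) monoid_scheme \<Rightarrow> 'g topology \<Rightarrow> 'y topology \<Rightarrow> ('g \<Rightarrow> 'y \<Rightarrow> 'y) \<Rightarrow> bool" where
  "minimal_flow G T Y \<phi> \<longleftrightarrow>
     flow G T Y \<phi> \<and> topspace Y \<noteq> {} \<and>
     (\<forall>y\<in>topspace Y. Y closure_of (orbit G \<phi> y) = topspace Y)"

definition factor_map ::
  "('g, 'b) monoid_scheme \<Rightarrow> 'm topology \<Rightarrow> ('g \<Rightarrow> 'm \<Rightarrow> 'm) \<Rightarrow>
   'y topology \<Rightarrow> ('g \<Rightarrow> 'y \<Rightarrow> 'y) \<Rightarrow> ('m \<Rightarrow> 'y) \<Rightarrow> bool" where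
  "factor_map G M \<phi> Y \<psi> f \<longleftrightarrow>
     continuous_map M Y f \<and> f ` topspace M = topspace Y \<and>
     (\<forall>g\<in>carrier G. \<forall>x\<in>topspace M. f (\<phi> g x) = \<psi> g (f x))"

text \<open>A definition cannot quantify over all types, so the minimal flows tested here live on
  \<open>'g set set\<close>. No generality is lost: a minimal flow is the closure of one orbit, so it has
  at most as many points as there are families of subsets of \<open>G\<close>. The lemmas below show that a
  universal minimal flow in this sense maps onto the minimal flows carried by an arbitrary type.\<close>

definition universal_minimal_flow ::
  "('g, 'b) monoid_scheme \<Rightarrow> 'g topology \<Rightarrow> 'm topology \<Rightarrow> ('g \<Rightarrow> 'm \<Rightarrow> 'm) \<Rightarrow> bool" where
  "universal_minimal_flow G T M \<phi> \<longleftrightarrow>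
     minimal_flow G T M \<phi> \<and>
     (\<forall>(Y :: 'g set set topology) \<psi>. minimal_flow G T Y \<psi> \<longrightarrow> (\<exists>f. factor_map G M \<phi> Y \<psi> f))"

lemma minimal_flow_inj_set_set:
  fixes Y :: "'y topology" and G :: "('g, 'b) monoid_scheme"
  assumes "minimal_flow G T Y \<psi>"
  shows "\<exists>h :: 'y \<Rightarrow> 'g set set. inj_on h (topspace Y)"
proof -
  have H: "Hausdorff_space Y" "compact_space Y" and ga: "group_action G (topspace Y) \<psi>"
    using assms by (auto simp: minimal_flow_def flow_def)
  obtain p where p: "p \<in> topspace Y"
    using assms unfolding minimal_flow_def by blast
  have dense: "Y closure_of (orbit G \<psi> p) = topspace Y"
    using assms p by (auto simp: minimal_flow_def)
  define h where "h y = {A. y \<in> Y closure_of ((\<lambda>g. \<psi> g p) ` (A \<inter> carrier G))}" for y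
  have "inj_on h (topspace Y)"
  proof (rule inj_onI, rule ccontr)
    fix y z assume y: "y \<in> topspace Y" and z: "z \<in> topspace Y" and eq: "h y = h z" and "y \<noteq> z"
    have "\<exists>U V. openin Y U \<and> openin Y V \<and> y \<in> U \<and> z \<in> V \<and> disjnt U V"
      using H(1)[unfolded Hausdorff_space_def, rule_format, of y z] y z \<open>y \<noteq> z\<close> by simp
    then obtain U V where UV: "openin Y U" "openin Y V" "y \<in> U" "z \<in> V" "disjnt U V"
      by auto
    define A where "A = {g \<in> carrier G. \<psi> g p \<in> U}"
    have "A \<in> h y"
      unfolding h_def mem_Collect_eq in_closure_of
    proof (intro conjI allI impI y)
      fix W assume W: "y \<in> W \<and> openin Y W"
      then have "openin Y (W \<inter> U)" "y \<in> W \<inter> U" using UV by auto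
      moreover have "y \<in> Y closure_of (orbit G \<psi> p)" using dense y by simp
      ultimately have "\<exists>v. v \<in> orbit G \<psi> p \<and> v \<in> W \<inter> U"
        unfolding in_closure_of by blast
      then obtain g where "g \<in> carrier G" "\<psi> g p \<in> W \<inter> U" by (auto simp: orbit_def)
      then show "\<exists>v. v \<in> (\<lambda>g. \<psi> g p) ` (A \<inter> carrier G) \<and> v \<in> W" by (auto simp: A_def)
    qed
    moreover have "A \<notin> h z"
    proof
      assume "A \<in> h z"
      then obtain v where "v \<in> (\<lambda>g. \<psi> g p) ` (A \<inter> carrier G)" "v \<in> V"
        using UV(2,4) unfolding h_def mem_Collect_eq in_closure_of by blast
      with UV(5) show False by (auto simp: A_def disjnt_iff)
    qed
    ultimately show False using eq by simp
  qed
  then show ?thesis by blast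
qed

lemma minimal_flow_transfer:
  fixes Y :: "'y topology" and h :: "'y \<Rightarrow> 'z"
  assumes m: "minimal_flow G T Y \<psi>" and inj: "inj_on h (topspace Y)"
  shows "\<exists>(Z :: 'z topology) \<theta> k. minimal_flow G T Z \<theta> \<and> homeomorphic_maps Y Z h k \<and>
           (\<forall>g\<in>carrier G. \<forall>y\<in>topspace Y. h (\<psi> g y) = \<theta> g (h y))"
proof -
  have H: "Hausdorff_space Y" "compact_space Y" and ga: "group_action G (topspace Y) \<psi>"
    and cont: "continuous_map (prod_topology T Y) Y (\<lambda>(g, y). \<psi> g y)"
    using m by (auto simp: minimal_flow_def flow_def)
  interpret ga: group_action G "topspace Y" \<psi> by (rule ga)
  interpret gh: group_hom G "BijGroup (topspace Y)" \<psi> by (rule ga.group_hom)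
  define k where "k = inv_into (topspace Y) h"
  define Z where "Z = pullback_topology (h ` topspace Y) k Y"
  define \<theta> where "\<theta> g = restrict (\<lambda>z. h (\<psi> g (k z))) (topspace Z)" for g
  have kh: "k (h y) = y" if "y \<in> topspace Y" for y
    using that inj by (simp add: k_def)
  have tZ: "topspace Z = h ` topspace Y"
    by (auto simp: Z_def topspace_pullback_topology kh)
  have hk: "h (k z) = z" "k z \<in> topspace Y" if "z \<in> topspace Z" for z
    using that by (auto simp: tZ kh)
  have ck: "continuous_map Z Y k"
    using continuous_map_pullback[of Y Y id "h ` topspace Y" k] by (simp add: Z_def)
  have ch: "continuous_map Y Z h"
    unfolding Z_def
  proof (rule continuous_map_pullback')
    show "continuous_map Y Y (k \<circ> h)"
      by (rule continuous_map_eq[OF continuous_map_id]) (simp add: kh)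
    show "topspace Y \<subseteq> h -` h ` topspace Y" by blast
  qed
  have hm: "homeomorphic_maps Y Z h k"
    by (simp add: homeomorphic_maps_def ch ck kh hk)
  then have hom: "homeomorphic_map Y Z h" "Y homeomorphic_space Z"
    by (auto simp: homeomorphic_maps_map homeomorphic_space_def)
  have \<psi>: "\<psi> g y \<in> topspace Y" if "g \<in> carrier G" "y \<in> topspace Y" for g y
    using that ga.element_image by blast
  have eqv: "h (\<psi> g y) = \<theta> g (h y)" if "y \<in> topspace Y" for g y
    using that by (simp add: \<theta>_def tZ kh)
  have \<theta>Bij: "\<theta> g \<in> Bij (topspace Z)" if g: "g \<in> carrier G" for g
  proof -
    have "bij_betw (\<lambda>z. h (\<psi> g (k z))) (topspace Z) (topspace Z)"
    proof (rule bij_betw_imageI)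
      show "inj_on (\<lambda>z. h (\<psi> g (k z))) (topspace Z)"
        by (rule inj_onI) (metis \<psi> g ga.inj_prop hk inj inj_onD)
      show "(\<lambda>z. h (\<psi> g (k z))) ` topspace Z = topspace Z"
        using ga.surj_prop[OF g] kh by (force simp: tZ image_image)
    qed
    then show ?thesis by (simp add: Bij_def \<theta>_def)
  qed
  have "group_action G (topspace Z) \<theta>"
  proof (intro group_action.intro group_hom.intro group_hom_axioms.intro homI)
    show "group G" by (rule gh.G.is_group)
    show "group (BijGroup (topspace Z))" by (rule group_BijGroup)
    show "\<theta> x \<in> carrier (BijGroup (topspace Z))" if "x \<in> carrier G" for x
      using \<theta>Bij that by (simp add: BijGroup_def)
    show "\<theta> (x \<otimes>\<^bsub>G\<^esub> y) = \<theta> x \<otimes>\<^bsub>BijGroup (topspace Z)\<^esub> \<theta> y"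
      if "x \<in> carrier G" "y \<in> carrier G" for x y
    proof (rule extensionalityI[where A = "topspace Z"])
      show "\<theta> (x \<otimes>\<^bsub>G\<^esub> y) \<in> extensional (topspace Z)" by (simp add: \<theta>_def)
      show "\<theta> x \<otimes>\<^bsub>BijGroup (topspace Z)\<^esub> \<theta> y \<in> extensional (topspace Z)"
        using \<theta>Bij that by (simp add: BijGroup_def compose_def)
      fix z assume "z \<in> topspace Z"
      then obtain v where v: "v \<in> topspace Y" "z = h v" by (auto simp: tZ)
      have "\<theta> (x \<otimes>\<^bsub>G\<^esub> y) z = \<theta> x (\<theta> y z)"
        using v that ga.composition_rule[OF v(1) that] \<psi>[OF that(2) v(1)]
        by (simp only: v(2) eqv[OF v(1), symmetric] eqv[OF \<psi>[OF that(2) v(1)], symmetric])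
      with \<open>z \<in> topspace Z\<close> show "\<theta> (x \<otimes>\<^bsub>G\<^esub> y) z = (\<theta> x \<otimes>\<^bsub>BijGroup (topspace Z)\<^esub> \<theta> y) z"
        using \<theta>Bij that by (simp add: BijGroup_def compose_def)
    qed
  qed
  moreover have "continuous_map (prod_topology T Z) Z (\<lambda>(g, z). \<theta> g z)"
  proof (rule continuous_map_eq)
    show "continuous_map (prod_topology T Z) Z
            (h \<circ> (\<lambda>(g, y). \<psi> g y) \<circ> (\<lambda>(g, z). (g, k z)))"
      by (intro continuous_map_compose[OF _ continuous_map_compose[OF cont ch]])
        (auto simp: continuous_map_prod_top ck[unfolded id_def])
    show "(h \<circ> (\<lambda>(g, y). \<psi> g y) \<circ> (\<lambda>(g, z). (g, k z))) p = (\<lambda>(g, z). \<theta> g z) p"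
      if "p \<in> topspace (prod_topology T Z)" for p
      using that by (auto simp: \<theta>_def)
  qed
  moreover have "Hausdorff_space Z" "compact_space Z"
    using H hom homeomorphic_Hausdorff_space homeomorphic_compact_space by blast+
  moreover have "topspace Z \<noteq> {}" using m by (auto simp: tZ minimal_flow_def)
  moreover have "Z closure_of (orbit G \<theta> z) = topspace Z" if z: "z \<in> topspace Z" for z
  proof -
    obtain y where y: "y \<in> topspace Y" "z = h y" using z unfolding tZ by blast
    have "orbit G \<theta> z = h ` orbit G \<psi> y" unfolding orbit_def y(2) eqv[OF y(1), symmetric] by blast
    moreover have "orbit G \<psi> y \<subseteq> topspace Y" using \<psi> y by (auto simp: orbit_def)
    ultimately show ?thesis
      using m y by (simp add: homeomorphic_map_closure_of[OF hom(1)] minimal_flow_def tZ)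
  qed
  ultimately have "minimal_flow G T Z \<theta>" by (simp add: minimal_flow_def flow_def)
  with hm eqv show ?thesis by blast
qed

lemma universal_minimal_flow_factor_map:
  fixes M :: "'m topology" and Y :: "'y topology"
  assumes "universal_minimal_flow G T M \<phi>" and "minimal_flow G T Y \<psi>"
  shows "\<exists>f. factor_map G M \<phi> Y \<psi> f"
proof -
  obtain h :: "'y \<Rightarrow> 'a set set" where h: "inj_on h (topspace Y)"
    using minimal_flow_inj_set_set[OF assms(2)] by blast
  obtain Z :: "'a set set topology" and \<theta> k where Z: "minimal_flow G T Z \<theta>"
    and hm: "homeomorphic_maps Y Z h k"
    and eqv: "\<And>g y. g \<in> carrier G \<Longrightarrow> y \<in> topspace Y \<Longrightarrow> h (\<psi> g y) = \<theta> g (h y)"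
    using minimal_flow_transfer[OF assms(2) h] by metis
  obtain f where f: "factor_map G M \<phi> Z \<theta> f"
    using assms(1) Z by (auto simp: universal_minimal_flow_def)
  interpret ga: group_action G "topspace Y" \<psi>
    using assms(2) by (simp add: minimal_flow_def flow_def)
  have 1: "continuous_map M Y (k \<circ> f)"
    using f hm by (auto simp: factor_map_def homeomorphic_maps_def intro: continuous_map_compose)
  have "k ` topspace Z = topspace Y"
    using hm homeomorphic_imp_surjective_map homeomorphic_maps_map by blast
  then have 2: "(k \<circ> f) ` topspace M = topspace Y"
    using f by (simp add: factor_map_def flip: image_image)
  have 3: "(k \<circ> f) (\<phi> g x) = \<psi> g ((k \<circ> f) x)" if g: "g \<in> carrier G" and x: "x \<in> topspace M" for g x
  proof -
    have fx: "f x \<in> topspace Z" using f x by (auto simp: factor_map_def)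
    then have kfx: "k (f x) \<in> topspace Y" "h (k (f x)) = f x"
      using 2 x hm by (auto simp: homeomorphic_maps_def)
    have "f (\<phi> g x) = h (\<psi> g (k (f x)))"
      using f g x eqv[OF g kfx(1)] kfx by (simp add: factor_map_def)
    moreover have "\<psi> g (k (f x)) \<in> topspace Y" using ga.element_image g kfx by blast
    ultimately show ?thesis using hm by (simp add: homeomorphic_maps_def)
  qed
  show ?thesis using 1 2 3 by (auto simp: factor_map_def simp del: comp_apply)
qed

end

theory Submission
  imports Defs
begin

text \<open>A universal minimal flow maps onto every minimal flow, so it suffices to exhibit a minimal flow
  that is not a continuous image of a compact metrizable space. Fix a continuous map \<open>p\<close> from \<open>X\<close> to
  the plane that restricts to a coordinate projection on a chart, and consider the right-invariant
  pseudometric on \<open>G\<close> given by the uniform distance of \<open>p \<circ> g\<close> and \<open>p \<circ> h\<close>. Given a path in \<open>X\<close>, colour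
  a homeomorphism \<open>g\<close> by \<open>i\<close> if the image of the path under \<open>g\<close> winds, inside the chart, \<open>i\<close> times
  around an annulus while moving from its inner to its outer boundary. Lifting the argument along
  the path shows that distinct colours are at distance at least \<open>1/4\<close>. By local transitivity and
  compactness there are finite sets \<open>B i\<close> such that every \<open>g\<close> of a given finite set gets colour \<open>i\<close>
  after multiplication by an element of \<open>B i\<close>, provided the path is chosen to visit enough points.
  For a set \<open>S\<close> of colours there is a Lipschitz function that is \<open>0\<close> on the colours in \<open>S\<close> and \<open>1\<close> on
  the others. By compactness these families of functions accumulate, as the path varies, at a
  nonempty flow each of whose points has, for every colour \<open>i\<close>, a translate \<open>z i\<close> taking the value
  \<open>0\<close> or \<open>1\<close> prescribed for \<open>i\<close> at every \<open>S\<close>. No subsequence of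
  the \<open>z i\<close> converges: take for \<open>S\<close> every second colour along the subsequence.\<close>


section \<open>Winding numbers of paths\<close>

text \<open>Circles about 0 are rotated rigidly, by an angle that rises from 0 on the unit circle to
  \<open>2 * pi * k\<close> on the circle of radius 2. For integral \<open>k\<close> this is a
  \<open>k\<close>-fold Dehn twist of the annulus between them; the clamp extends it to the whole
  plane.\<close>

definition twist :: "real \<Rightarrow> complex \<Rightarrow> complex" where
  "twist k z = z * cis (2 * pi * k * max 0 (min 1 (cmod z - 1)))"

lemma norm_twist [simp]: "cmod (twist k z) = cmod z"
  by (simp add: twist_def norm_mult)

text \<open>The rotation angle depends on the modulus alone, which a twist preserves, so angles add.
  In particular \<open>twist (- k)\<close> inverts \<open>twist k\<close>.\<close>

lemma twist_twist [simp]: "twist k (twist l z) = twist (k + l) z"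
proof -
  let ?c = "max 0 (min 1 (cmod z - 1))"
  have "twist k (twist l z) = z * (cis (2 * pi * l * ?c) * cis (2 * pi * k * ?c))"
    unfolding twist_def[of k] norm_twist by (simp only: twist_def mult.assoc)
  also have "2 * pi * l * ?c + 2 * pi * k * ?c = 2 * pi * (k + l) * ?c" by algebra
  then have "cis (2 * pi * l * ?c) * cis (2 * pi * k * ?c) = cis (2 * pi * (k + l) * ?c)"
    by (simp only: cis_mult)
  finally show ?thesis by (simp only: twist_def)
qed

lemma twist_0 [simp]: "twist 0 z = z"
  by (simp add: twist_def)

lemma twist_eq_self: "cmod z \<le> 1 \<Longrightarrow> twist k z = z"
  by (simp add: twist_def)

lemma continuous_on_twist: "continuous_on S (twist k)"
  unfolding twist_def by (intro continuous_intros)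

text \<open>On the spiral strip, the logarithm yields a continuous branch of the argument that grows
  from about \<open>0\<close> inside the unit circle to about \<open>2 \<pi> k\<close> outside the circle of radius \<open>2\<close>.\<close>

definition spiral :: "real \<Rightarrow> complex set" where
  "spiral k = {z. 1/2 < cmod z \<and> 0 < Re (twist (- k) z)}"

definition spiral_arg :: "real \<Rightarrow> complex \<Rightarrow> real" where
  "spiral_arg k z = Im (Ln (twist (- k) z)) + 2 * pi * k * max 0 (min 1 (cmod z - 1))"

lemma continuous_on_spiral_arg: "continuous_on (spiral k) (spiral_arg k)"
proof -
  have "continuous_on (spiral k) (\<lambda>z. Ln (twist (- k) z))"
    by (rule continuous_on_compose2[OF continuous_on_Ln[of "{z. 0 < Re z}"] continuous_on_twist])
      (auto simp: spiral_def complex_nonpos_Reals_iff)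
  then show ?thesis
    unfolding spiral_arg_def by (intro continuous_on_add continuous_on_Im) (assumption, intro continuous_intros)
qed

text \<open>Untwisting subtracts exactly the angle that the second summand of
  \<open>spiral_arg\<close> adds back. So the branch is a genuine argument, although its values may
  exceed \<open>pi\<close>.\<close>

lemma cis_spiral_arg:
  assumes "z \<in> spiral k" shows "z = cmod z * cis (spiral_arg k z)"
proof -
  let ?c = "2 * pi * k * max 0 (min 1 (cmod z - 1))" and ?w = "twist (- k) z"
  have "?w \<noteq> 0" using assms by (auto simp: spiral_def)
  then have w: "?w = cmod z * cis (Im (Ln ?w))"
    by (metis exp_eq_polar exp_Ln norm_exp_eq_Re norm_twist of_real_exp)
  have "z = twist k ?w" by simp
  also have "\<dots> = ?w * cis ?c" by (simp only: twist_def[of k ?w] norm_twist)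
  also have "\<dots> = cmod z * cis (Im (Ln ?w)) * cis ?c" by (subst w) (rule refl)
  also have "\<dots> = cmod z * cis (spiral_arg k z)"
    by (simp only: spiral_arg_def cis_mult mult.assoc)
  finally show ?thesis .
qed

text \<open>Off the annulus the clamp is constantly 0 or 1, and the untwisted point lies in the
  right half-plane, where the principal argument is below \<open>pi / 2\<close> in absolute value.
  This pins the branch at both ends of a path.\<close>

lemma spiral_arg_inner: "z \<in> spiral k \<Longrightarrow> cmod z \<le> 1 \<Longrightarrow> \<bar>spiral_arg k z\<bar> < pi / 2"
  and spiral_arg_outer: "z \<in> spiral k \<Longrightarrow> 2 \<le> cmod z \<Longrightarrow> \<bar>spiral_arg k z - 2 * pi * k\<bar> < pi / 2"
  by (auto simp: spiral_arg_def spiral_def dest: Re_Ln_pos_lt_imp)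

text \<open>Law of cosines: \<open>2 * Re (z * cnj w)\<close> is the sum of the squared moduli minus
  the squared distance, and one squared modulus alone outweighs the latter. This compares branches
  that belong to different spirals.\<close>

lemma cos_spiral_arg_diff_pos:
  assumes "z \<in> spiral k" "w \<in> spiral l" "dist z w < 1/4"
  shows "0 < cos (spiral_arg k z - spiral_arg l w)"
proof -
  have zw: "1/2 < cmod z" "1/2 < cmod w" using assms by (auto simp: spiral_def)
  have "(dist z w)\<^sup>2 = (cmod z)\<^sup>2 + (cmod w)\<^sup>2 - 2 * Re (z * cnj w)"
    by (simp add: dist_norm cmod_power2) (simp add: power2_eq_square algebra_simps)
  moreover have "(dist z w)\<^sup>2 < (1/2)\<^sup>2" using assms by (intro power_strict_mono) auto
  moreover have "(1/2)\<^sup>2 < (cmod z)\<^sup>2" using zw by (intro power_strict_mono) auto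
  moreover have "0 \<le> (cmod w)\<^sup>2" by simp
  ultimately have pos: "0 < Re (z * cnj w)" by linarith
  have "z * cnj w = (cmod z * cis (spiral_arg k z)) * cnj (cmod w * cis (spiral_arg l w))"
    by (rule arg_cong2[of _ _ _ _ "\<lambda>z w. z * cnj w", OF assms(1,2)[THEN cis_spiral_arg]])
  also have "\<dots> = (cmod z * cmod w) * cis (spiral_arg k z - spiral_arg l w)"
    using cis_mult[of "spiral_arg k z" "- spiral_arg l w"] by (simp add: cis_cnj)
  finally have "Re (z * cnj w) = (cmod z * cmod w) * cos (spiral_arg k z - spiral_arg l w)"
    by (simp flip: of_real_mult)
  moreover have "0 < cmod z * cmod w" using zw by (intro mult_pos_pos) auto
  ultimately show ?thesis using pos zero_less_mult_pos by metis
qed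

text \<open>The difference of the two branches along the paths cannot reach \<open>pi / 2\<close> in
  absolute value, since its cosine stays positive. It thus remains near 0, whereas at time
  \<open>t\<close> it is close to \<open>2 * pi * (i - j)\<close>.\<close>

lemma spiral_paths_same_winding:
  fixes u v :: "real \<Rightarrow> complex" and i j :: nat
  assumes "0 \<le> t" and u: "continuous_on {0..t} u" "u \<in> {0..t} \<rightarrow> spiral i"
    and v: "continuous_on {0..t} v" "v \<in> {0..t} \<rightarrow> spiral j"
    and near: "\<And>s. s \<in> {0..t} \<Longrightarrow> dist (u s) (v s) < 1/4"
    and start: "cmod (u 0) \<le> 1" "cmod (v 0) \<le> 1" and stop: "2 \<le> cmod (u t)" "2 \<le> cmod (v t)"
  shows "i = j"
proof -
  define f where "f s = spiral_arg i (u s) - spiral_arg j (v s)" for s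
  have cont: "continuous_on {0..t} f"
    unfolding f_def using u v
    by (intro continuous_on_diff continuous_on_compose2[OF continuous_on_spiral_arg]) auto
  have cos_f: "0 < cos (f s)" if "s \<in> {0..t}" for s
    unfolding f_def using that u v near by (intro cos_spiral_arg_diff_pos) auto
  have 0: "0 \<in> {0..t}" "t \<in> {0..t}" using \<open>0 \<le> t\<close> by auto
  have "\<bar>spiral_arg i (u 0)\<bar> < pi / 2" "\<bar>spiral_arg j (v 0)\<bar> < pi / 2"
    using 0 u v start spiral_arg_inner[of _ "real i"] spiral_arg_inner[of _ "real j"] by blast+
  then have "\<bar>f 0\<bar> < pi" by (auto simp: f_def)
  \<comment> \<open>The two inner bounds only give \<open>pi\<close> for the difference; positivity
    of the cosine sharpens this to \<open>pi / 2\<close>.\<close>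
  have f0: "\<bar>f 0\<bar> < pi / 2"
  proof (rule ccontr)
    assume "\<not> \<bar>f 0\<bar> < pi / 2"
    then have "cos \<bar>f 0\<bar> \<le> cos (pi / 2)"
      using \<open>\<bar>f 0\<bar> < pi\<close> by (intro cos_monotone_0_pi_le) auto
    with cos_f[OF 0(1)] show False by (simp add: cos_abs_real)
  qed
  have ft: "\<bar>f t\<bar> < pi / 2"
  proof (rule ccontr)
    assume "\<not> \<bar>f t\<bar> < pi / 2"
    moreover have "continuous_on {0..t} (\<lambda>s. \<bar>f s\<bar>)" using cont by (intro continuous_intros)
    ultimately obtain s where "s \<in> {0..t}" "\<bar>f s\<bar> = pi / 2"
      using IVT'[of "\<lambda>s. \<bar>f s\<bar>" 0 "pi/2" t] f0 \<open>0 \<le> t\<close> by auto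
    then show False using cos_f[of s] cos_abs_real[of "f s"] cos_pi_half by (metis less_irrefl)
  qed
  have "\<bar>spiral_arg i (u t) - 2 * pi * i\<bar> < pi / 2" "\<bar>spiral_arg j (v t) - 2 * pi * j\<bar> < pi / 2"
    using 0 u v stop spiral_arg_outer[of _ "real i"] spiral_arg_outer[of _ "real j"] by blast+
  \<comment> \<open>Three errors below \<open>pi / 2\<close> add up to less than
    \<open>2 * pi\<close>, the least gap between distinct winding numbers.\<close>
  with ft have "\<bar>2 * pi * i - 2 * pi * j\<bar> < 3 / 2 * pi"
    unfolding f_def by linarith
  moreover have "2 * pi * i - 2 * pi * j = pi * (2 * (real i - real j))" by (simp add: algebra_simps)
  ultimately have "pi * \<bar>2 * (real i - real j)\<bar> < pi * (3/2)"
    by (simp add: abs_mult)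
  then have "\<bar>2 * (real i - real j)\<bar> < 3/2" by (simp add: mult_less_cancel_left)
  then have "\<bar>real i - real j\<bar> < 1" unfolding abs_mult by simp
  then show "i = j" by linarith
qed


section \<open>Minimal subflows\<close>

text \<open>The action of the inverse element is a two-sided inverse map, so bijectivity need not be
  assumed. Extensionality is, because elements of \<open>BijGroup\<close> are normalised outside the
  set.\<close>

lemma group_actionI:
  assumes "group G"
    and ext: "\<And>g. g \<in> carrier G \<Longrightarrow> \<phi> g \<in> extensional E"
    and closed: "\<And>g x. g \<in> carrier G \<Longrightarrow> x \<in> E \<Longrightarrow> \<phi> g x \<in> E"
    and one: "\<And>x. x \<in> E \<Longrightarrow> \<phi> \<one>\<^bsub>G\<^esub> x = x"
    and mult: "\<And>g h x. g \<in> carrier G \<Longrightarrow> h \<in> carrier G \<Longrightarrow> x \<in> E \<Longrightarrow>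
      \<phi> (g \<otimes>\<^bsub>G\<^esub> h) x = \<phi> g (\<phi> h x)"
  shows "group_action G E \<phi>"
proof -
  interpret G: group G by fact
  have inv: "\<phi> g (\<phi> (inv\<^bsub>G\<^esub> g) x) = x" "\<phi> (inv\<^bsub>G\<^esub> g) (\<phi> g x) = x"
    if "g \<in> carrier G" "x \<in> E" for g x
    using that one mult[symmetric] by simp_all
  have Bij: "\<phi> g \<in> Bij E" if "g \<in> carrier G" for g
    unfolding Bij_def using that ext closed inv
    by (auto intro!: bij_betw_byWitness[where f' = "\<phi> (inv\<^bsub>G\<^esub> g)"])
  have "\<phi> (g \<otimes>\<^bsub>G\<^esub> h) = compose E (\<phi> g) (\<phi> h)" if "g \<in> carrier G" "h \<in> carrier G" for g h
    using that ext mult by (intro extensionalityI[of _ E]) (auto simp: compose_def)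
  then have "\<phi> \<in> hom G (BijGroup E)"
    using Bij by (intro homI) (auto simp: BijGroup_def)
  then show ?thesis
    by (simp add: group_action_def group_hom_def group_hom_axioms_def group_BijGroup G.is_group)
qed

text \<open>Zorn's lemma for reverse inclusion yields a minimal nonempty closed invariant set,
  compactness supplying lower bounds of chains. The closure of any orbit inside it is again such a
  set, hence all of it.\<close>

lemma minimal_subflow_exists:
  assumes fl: "flow G T Y \<phi>" and ne: "topspace Y \<noteq> {}" and T: "topspace T = carrier G"
  obtains Z where "Z \<subseteq> topspace Y" "minimal_flow G T (subtopology Y Z) (\<lambda>g. restrict (\<phi> g) Z)"
proof -
  have comp: "compact_space Y" and Haus: "Hausdorff_space Y"
    and ga: "group_action G (topspace Y) \<phi>"
    and cont: "continuous_map (prod_topology T Y) Y (\<lambda>(g, y). \<phi> g y)"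
    using fl by (auto simp: flow_def)
  interpret group_action G "topspace Y" \<phi> by fact
  interpret gh: group_hom G "BijGroup (topspace Y)" \<phi> by (rule group_hom)
  have \<phi>1: "\<phi> \<one>\<^bsub>G\<^esub> y = y" if "y \<in> topspace Y" for y
    using that id_eq_one by (metis restrict_apply')
  define \<C> where
    "\<C> = {C. closedin Y C \<and> C \<noteq> {} \<and> (\<forall>g\<in>carrier G. \<forall>y\<in>C. \<phi> g y \<in> C)}"
  have "\<exists>U\<in>\<C>. \<forall>C\<in>\<K>. U \<subseteq> C" if chain: "subset.chain \<C> \<K>" for \<K>
  proof (cases "\<K> = {}")
    case True
    have "topspace Y \<in> \<C>" using ne element_image by (auto simp: \<C>_def)
    with True show ?thesis by auto
  next
    case False
    have sub: "\<K> \<subseteq> \<C>" and lin: "\<And>A B. A \<in> \<K> \<Longrightarrow> B \<in> \<K> \<Longrightarrow> A \<subseteq> B \<or> B \<subseteq> A"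
      using chain unfolding subset_chain_def by auto
    \<comment> \<open>A nonempty finite subchain contains its own intersection; this is the finite
      intersection property.\<close>
    have "\<Inter>\<F> \<noteq> {}" if "finite \<F>" "\<F> \<subseteq> \<K>" for \<F>
    proof (cases "\<F> = {}")
      case nempty: False
      then have "\<Inter>\<F> \<in> \<F>"
        using that lin by (intro finite_Inf_in) (metis Int_absorb1 Int_absorb2 subsetD)+
      then show ?thesis using that sub by (auto simp: \<C>_def)
    qed auto
    then have "\<Inter>\<K> \<noteq> {}"
      using comp sub unfolding compact_space_fip \<C>_def by (metis (no_types, lifting) mem_Collect_eq subsetD)
    then have "\<Inter>\<K> \<in> \<C>"
      using sub False by (auto simp: \<C>_def intro!: closedin_Inter)
    then show ?thesis by blast
  qed
  moreover have "subset.chain \<C> \<K>" if "\<K> \<in> Chains (relation_of (\<lambda>A B. B \<subseteq> A) \<C>)" for \<K>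
    using that unfolding Chains_def relation_of_def subset_chain_def by blast
  ultimately have "\<exists>Z\<in>\<C>. \<forall>C\<in>\<C>. C \<subseteq> Z \<longrightarrow> C = Z"
    by (intro predicate_Zorn partial_order_on_relation_ofI) auto
  then obtain Z where "Z \<in> \<C>" and min: "\<And>C. C \<in> \<C> \<Longrightarrow> C \<subseteq> Z \<Longrightarrow> C = Z" by blast
  then have Z: "closedin Y Z" "Z \<noteq> {}" and inv: "\<And>g y. g \<in> carrier G \<Longrightarrow> y \<in> Z \<Longrightarrow> \<phi> g y \<in> Z"
    by (auto simp: \<C>_def)
  have ZY: "Z \<subseteq> topspace Y" using Z closedin_subset by blast
  have tZ: "topspace (subtopology Y Z) = Z" using ZY by auto
  have cont1: "continuous_map Y Y (\<phi> g)" if "g \<in> carrier G" for g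
  proof -
    have "continuous_map Y (prod_topology T Y) (\<lambda>y. (g, y))"
      using that T by (auto intro!: continuous_map_pairedI)
    from continuous_map_compose[OF this cont] show ?thesis by (simp add: comp_def)
  qed
  have ga': "group_action G Z (\<lambda>g. restrict (\<phi> g) Z)"
    using ZY inv \<phi>1 by (intro group_actionI) (auto simp: composition_rule subset_iff simp del: gh.hom_mult gh.hom_one)
  have cont': "continuous_map (prod_topology T (subtopology Y Z)) (subtopology Y Z)
          (\<lambda>(g, y). restrict (\<phi> g) Z y)"
  proof -
    have "prod_topology T (subtopology Y Z) = subtopology (prod_topology T Y) (topspace T \<times> Z)"
      by (metis prod_topology_subtopology(2) subtopology_restrict subtopology_topspace inf_top_right)
    then have "continuous_map (prod_topology T (subtopology Y Z)) Y (\<lambda>(g, y). \<phi> g y)"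
      using cont by (simp add: continuous_map_from_subtopology)
    then have "continuous_map (prod_topology T (subtopology Y Z)) Y (\<lambda>(g, y). restrict (\<phi> g) Z y)"
      by (rule continuous_map_eq) auto
    then show ?thesis
      using inv T by (auto simp: continuous_map_in_subtopology)
  qed
  have fl': "flow G T (subtopology Y Z) (\<lambda>g. restrict (\<phi> g) Z)"
    unfolding flow_def tZ using Z comp Haus
    by (intro conjI ga' cont')
      (simp_all add: Hausdorff_space_subtopology closedin_compact_space compact_space_subtopology)
  have orb: "subtopology Y Z closure_of orbit G (\<lambda>g. restrict (\<phi> g) Z) y = Z" if "y \<in> Z" for y
  proof -
    have eq: "orbit G (\<lambda>g. restrict (\<phi> g) Z) y = orbit G \<phi> y"
      using that by (simp add: orbit_def)
    have OZ: "orbit G \<phi> y \<subseteq> Z" using that inv by (auto simp: orbit_def)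
    have sub: "Y closure_of orbit G \<phi> y \<subseteq> Z" using OZ Z by (simp add: closure_of_minimal)
    have "y \<in> orbit G \<phi> y" 
      using \<phi>1[of y] that ZY gh.G.one_closed unfolding orbit_def by force
    then have y: "y \<in> Y closure_of orbit G \<phi> y"
      using OZ ZY closure_of_subset by (metis subset_iff)
    \<comment> \<open>Orbit closures are invariant because each \<open>\<phi> g\<close> is
      continuous and maps the orbit into itself.\<close>
    have "\<phi> g x \<in> Y closure_of orbit G \<phi> y" if "g \<in> carrier G" "x \<in> Y closure_of orbit G \<phi> y" for g x
    proof -
      have "\<phi> g ` orbit G \<phi> y \<subseteq> orbit G \<phi> y"
      proof
        fix z assume "z \<in> \<phi> g ` orbit G \<phi> y"
        then obtain h where "h \<in> carrier G" "z = \<phi> g (\<phi> h y)" by (auto simp: orbit_def)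
        then have "z = \<phi> (g \<otimes>\<^bsub>G\<^esub> h) y"
          using \<open>y \<in> Z\<close> ZY \<open>g \<in> carrier G\<close> composition_rule[of y g h] by auto
        then show "z \<in> orbit G \<phi> y"
          using gh.G.m_closed[OF \<open>g \<in> carrier G\<close> \<open>h \<in> carrier G\<close>] unfolding orbit_def by blast
      qed
      then have "Y closure_of (\<phi> g ` orbit G \<phi> y) \<subseteq> Y closure_of orbit G \<phi> y"
        by (rule closure_of_mono)
      moreover have "\<phi> g ` (Y closure_of orbit G \<phi> y) \<subseteq> Y closure_of (\<phi> g ` orbit G \<phi> y)"
        using cont1[OF that(1)] by (rule continuous_map_image_closure_subset)
      ultimately show ?thesis using that(2) by blast
    qed
    then have "Y closure_of orbit G \<phi> y \<in> \<C>" using y by (auto simp: \<C>_def)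
    with sub min have "Y closure_of orbit G \<phi> y = Z" by blast
    then show ?thesis
      using OZ by (simp add: eq closure_of_subtopology Int_absorb1)
  qed
  have "minimal_flow G T (subtopology Y Z) (\<lambda>g. restrict (\<phi> g) Z)"
    unfolding minimal_flow_def tZ using fl' Z orb by simp
  with ZY show thesis by (rule that)
qed


section \<open>Flows of Lipschitz functions\<close>

text \<open>Distinct elements may have distance 0, since the distance will be measured after
  composition with a non-injective map. Right invariance keeps Lipschitz bounds under translation.
  It says nothing about a common left factor, hence the separate clause \<open>d_continuous\<close>,
  which makes the translation action jointly continuous.\<close>

locale right_invariant_pseudometric = group G for G :: "('g, 'b) monoid_scheme" (structure) +
  fixes T :: "'g topology" and d :: "'g \<Rightarrow> 'g \<Rightarrow> real"
  assumes topspace_T: "topspace T = carrier G"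
    and d_refl: "g \<in> carrier G \<Longrightarrow> d g g = 0"
    and d_commute: "g \<in> carrier G \<Longrightarrow> h \<in> carrier G \<Longrightarrow> d g h = d h g"
    and d_triangle: "g \<in> carrier G \<Longrightarrow> h \<in> carrier G \<Longrightarrow> k \<in> carrier G \<Longrightarrow> d g k \<le> d g h + d h k"
    and d_right_inv: "g \<in> carrier G \<Longrightarrow> h \<in> carrier G \<Longrightarrow> k \<in> carrier G \<Longrightarrow>
      d (g \<otimes> k) (h \<otimes> k) = d g h"
    and d_continuous: "g \<in> carrier G \<Longrightarrow> h \<in> carrier G \<Longrightarrow> 0 < e \<Longrightarrow>
      \<exists>N. openin T N \<and> h \<in> N \<and> (\<forall>k\<in>N. d (g \<otimes> k) (g \<otimes> h) < e)"
begin

lemma d_nonneg: "g \<in> carrier G \<Longrightarrow> h \<in> carrier G \<Longrightarrow> 0 \<le> d g h"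
  using d_triangle[of g h g] d_refl[of g] d_commute[of g h] by simp

text \<open>A point is a family of functions on the group indexed by sets of colours; the function with
  index \<open>S\<close> is meant to separate the colours in \<open>S\<close> from the others.\<close>

definition colour_space :: "(nat set \<times> 'g \<Rightarrow> real) topology" where
  "colour_space = product_topology (\<lambda>_. top_of_set {0..1}) (UNIV \<times> carrier G)"

text \<open>The constant 4 permits a change from 0 to 1 between elements at distance
  \<open>1/4\<close>, the separation of distinct colours.\<close>

definition lipschitz_colourings :: "(nat set \<times> 'g \<Rightarrow> real) set" where
  "lipschitz_colourings = {F \<in> topspace colour_space.
     \<forall>S. \<forall>g\<in>carrier G. \<forall>h\<in>carrier G. \<bar>F (S, g) - F (S, h)\<bar> \<le> 4 * d g h}"

text \<open>Multiplying the argument on the right makes this a left action; the restriction keeps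
  the families extensional.\<close>

definition translate :: "'g \<Rightarrow> (nat set \<times> 'g \<Rightarrow> real) \<Rightarrow> nat set \<times> 'g \<Rightarrow> real" where
  "translate h F = restrict (\<lambda>(S, g). F (S, g \<otimes> h)) (UNIV \<times> carrier G)"

lemma translate_apply [simp]: "g \<in> carrier G \<Longrightarrow> translate h F (S, g) = F (S, g \<otimes> h)"
  by (simp add: translate_def)

lemma topspace_colour_space: "topspace colour_space = (UNIV \<times> carrier G) \<rightarrow>\<^sub>E {0..1}"
  by (simp add: colour_space_def)

lemma compact_colour_space: "compact_space colour_space"
  and Hausdorff_colour_space: "Hausdorff_space colour_space"
  by (auto simp: colour_space_def compact_space_product_topology Hausdorff_space_product_topology
      compact_space_subtopology Hausdorff_space_subtopology)

lemma continuous_map_colour_space_apply: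
  assumes "g \<in> carrier G" shows "continuous_map colour_space euclideanreal (\<lambda>F. F (S, g))"
proof -
  have "continuous_map colour_space (top_of_set {0..1}) (\<lambda>F. F (S, g))"
    unfolding colour_space_def using assms by (intro continuous_map_product_projection) auto
  then show ?thesis by (simp add: continuous_map_in_subtopology)
qed

lemma closedin_lipschitz_colourings: "closedin colour_space lipschitz_colourings"
proof -
  have *: "closedin colour_space {F \<in> topspace colour_space. \<bar>F (S, g) - F (S, h)\<bar> \<in> {..4 * d g h}}"
    if "g \<in> carrier G" "h \<in> carrier G" for S g h
    using that
    by (intro closedin_continuous_map_preimage[of _ euclideanreal] continuous_intros
        continuous_map_colour_space_apply) auto
  have "closedin colour_space (topspace colour_space \<inter> (\<Inter>(S, g, h) \<in> UNIV \<times> carrier G \<times> carrier G.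
      {F \<in> topspace colour_space. \<bar>F (S, g) - F (S, h)\<bar> \<in> {..4 * d g h}}))"
    using * by (intro closedin_Int closedin_INT) auto
  also have "topspace colour_space \<inter> (\<Inter>(S, g, h) \<in> UNIV \<times> carrier G \<times> carrier G.
      {F \<in> topspace colour_space. \<bar>F (S, g) - F (S, h)\<bar> \<in> {..4 * d g h}}) = lipschitz_colourings"
    by (auto simp: lipschitz_colourings_def)
  finally show ?thesis .
qed

lemma translate_lipschitz:
  assumes k: "k \<in> carrier G" and F: "F \<in> lipschitz_colourings"
  shows "translate k F \<in> lipschitz_colourings"
proof -
  have "translate k F \<in> topspace colour_space"
    using assms by (auto simp: lipschitz_colourings_def topspace_colour_space translate_def PiE_iff)
  moreover have "\<bar>translate k F (S, g) - translate k F (S, h)\<bar> \<le> 4 * d g h"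
    if "g \<in> carrier G" "h \<in> carrier G" for S g h
  proof -
    have "\<bar>F (S, g \<otimes> k) - F (S, h \<otimes> k)\<bar> \<le> 4 * d (g \<otimes> k) (h \<otimes> k)"
      using F k that by (simp add: lipschitz_colourings_def)
    then show ?thesis using k that by (simp add: d_right_inv)
  qed
  ultimately show ?thesis by (simp add: lipschitz_colourings_def)
qed

text \<open>Joint continuity is checked one coordinate at a time. A change of the group element is
  controlled by the Lipschitz bound, uniformly over all families in \<open>Z\<close>; a change of
  the family is controlled by the single coordinate \<open>(S, g \<otimes> h)\<close>.\<close>

lemma flow_translate:
  assumes Z: "closedin colour_space Z" "Z \<subseteq> lipschitz_colourings"
    and inv: "\<And>h F. h \<in> carrier G \<Longrightarrow> F \<in> Z \<Longrightarrow> translate h F \<in> Z"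
  shows "flow G T (subtopology colour_space Z) (\<lambda>h. restrict (translate h) Z)"
proof -
  have ZC: "Z \<subseteq> topspace colour_space" using Z closedin_subset by blast
  then have tZ: "topspace (subtopology colour_space Z) = Z" by auto
  have F_ext: "F (S, g) = undefined" if "F \<in> Z" "g \<notin> carrier G" for F S g
    using that ZC by (auto simp: topspace_colour_space PiE_iff extensional_def)
  have ga: "group_action G Z (\<lambda>h. restrict (translate h) Z)"
  proof (rule group_actionI)
    show "restrict (translate \<one>) Z F = F" if "F \<in> Z" for F
      using that F_ext[OF that] by (auto simp: translate_def fun_eq_iff restrict_def)
    show "restrict (translate (g \<otimes> h)) Z F = restrict (translate g) Z (restrict (translate h) Z F)"
      if "g \<in> carrier G" "h \<in> carrier G" "F \<in> Z" for g h F
      using that inv by (auto simp: translate_def fun_eq_iff restrict_def m_assoc)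
  qed (use inv is_group in auto)
  have cont: "continuous_map (prod_topology T (subtopology colour_space Z))
      (subtopology colour_space Z) (\<lambda>(h, F). restrict (translate h) Z F)"
  proof -
    let ?P = "prod_topology T (subtopology colour_space Z)"
    have tP: "topspace ?P = carrier G \<times> Z" by (simp only: topspace_prod_topology topspace_T tZ)
    have *: "continuous_map ?P euclideanreal (\<lambda>(h, F). F (S, g \<otimes> h))" if g: "g \<in> carrier G" for S g
    proof -
      have "\<exists>U. openin ?P U \<and> (h, F) \<in> U \<and>
          (\<forall>p\<in>U. dist (F (S, g \<otimes> h)) (case p of (h', F') \<Rightarrow> F' (S, g \<otimes> h')) < e)"
        if h: "h \<in> carrier G" and F: "F \<in> Z" and e: "0 < e" for h F e
      proof -
        \<comment> \<open>The Lipschitz constant 4 turns \<open>e / 8\<close> into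
          \<open>e / 2\<close>; the other half of \<open>e\<close> is kept for the change of the
          family.\<close>
        obtain N where N: "openin T N" "h \<in> N" "\<And>k. k \<in> N \<Longrightarrow> d (g \<otimes> k) (g \<otimes> h) < e / 8"
          using d_continuous[of g h "e / 8"] g h e by auto
        define W where "W = {F' \<in> topspace (subtopology colour_space Z). 
          F' (S, g \<otimes> h) \<in> ball (F (S, g \<otimes> h)) (e / 2)}"
        have "openin (subtopology colour_space Z) W"
          unfolding W_def using g h
          by (intro openin_continuous_map_preimage[of _ euclideanreal] continuous_map_from_subtopology
              continuous_map_colour_space_apply) auto
        then have "openin ?P (N \<times> W)" using N by (simp add: openin_prod_Times_iff)
        moreover have "(h, F) \<in> N \<times> W" using N F tZ e by (simp add: W_def)
        moreover have "dist (F (S, g \<otimes> h)) (F' (S, g \<otimes> k)) < e" if "k \<in> N" "F' \<in> W" for k F'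
        proof -
          have k: "k \<in> carrier G" using that N topspace_T openin_subset by blast
          have "F' \<in> Z" using that tZ by (simp add: W_def)
          then have "\<bar>F' (S, g \<otimes> k) - F' (S, g \<otimes> h)\<bar> \<le> 4 * d (g \<otimes> k) (g \<otimes> h)"
            using Z g h k by (auto simp: lipschitz_colourings_def)
          also have "\<dots> < e / 2" using N(3)[OF that(1)] by simp
          finally have "\<bar>F' (S, g \<otimes> k) - F' (S, g \<otimes> h)\<bar> < e / 2" .
          moreover have "dist (F (S, g \<otimes> h)) (F' (S, g \<otimes> h)) < e / 2"
            using that(2) by (simp add: W_def)
          ultimately show ?thesis unfolding dist_real_def by linarith
        qed
        ultimately show ?thesis by (intro exI[of _ "N \<times> W"]) auto
      qed
      then have "\<forall>p\<in>topspace ?P. \<forall>e>0. \<exists>U. openin ?P U \<and> p \<in> U \<and>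
          (\<forall>q\<in>U. (\<lambda>(h, F). F (S, g \<otimes> h)) q \<in> ball ((\<lambda>(h, F). F (S, g \<otimes> h)) p) e)"
        unfolding tP by auto
      then show ?thesis
        using Met_TC.continuous_map_to_metric[of ?P "\<lambda>(h, F). F (S, g \<otimes> h)"] by simp
    qed
    have comp: "continuous_map ?P (top_of_set {0..1})
        (\<lambda>p. (case p of (h, F) \<Rightarrow> restrict (translate h) Z F) (S, g))"
      if g: "g \<in> carrier G" for S g
    proof -
      have "continuous_map ?P euclideanreal
          (\<lambda>p. (case p of (h, F) \<Rightarrow> restrict (translate h) Z F) (S, g))"
        by (rule continuous_map_eq[OF *[OF g, of S]]) (use g tP in auto)
      moreover have "translate h F (S, g) \<in> {0..1}" if "h \<in> carrier G" "F \<in> Z" for h F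
        using inv[OF that] ZC g by (auto simp: topspace_colour_space PiE_iff)
      ultimately show ?thesis
        using tP by (auto simp: continuous_map_in_subtopology)
    qed
    have "continuous_map ?P colour_space (\<lambda>(h, F). restrict (translate h) Z F)"
      unfolding colour_space_def continuous_map_componentwise
    proof (intro conjI ballI)
      show "(\<lambda>(h, F). restrict (translate h) Z F) `
          topspace (prod_topology T (subtopology (product_topology (\<lambda>_. top_of_set {0..1})
            (UNIV \<times> carrier G)) Z)) \<subseteq> extensional (UNIV \<times> carrier G)"
        using tP unfolding colour_space_def by (auto simp: translate_def)
    qed (use comp[unfolded colour_space_def] in \<open>simp only: mem_Times_iff split_paired_all snd_conv simp_thms\<close>)
    then show ?thesis
      using inv tP by (auto simp: continuous_map_in_subtopology)
  qed
  show ?thesis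
    unfolding flow_def tZ using Z compact_colour_space Hausdorff_colour_space
    by (intro conjI ga cont)
      (simp_all add: Hausdorff_space_subtopology closedin_compact_space compact_space_subtopology)
qed


text \<open>The finite sets \<open>B i\<close> are fixed before \<open>Q\<close>, while the colour
  classes may depend on \<open>Q\<close>. Having translates by \<open>B i\<close> with the
  prescribed values is therefore a closed condition that survives the passage from finite
  \<open>Q\<close> to the whole group. A compact metrizable \<open>M\<close> is sequentially compact
  and cannot map onto a flow of such families.\<close>

theorem universal_minimal_flow_not_metrizable:
  fixes M :: "'m topology" and B :: "nat \<Rightarrow> 'g set"
  assumes umf: "universal_minimal_flow G T M \<phi>"
    and B: "\<And>i. finite (B i)" "\<And>i. B i \<subseteq> carrier G"
    and colours: "\<And>Q. finite Q \<Longrightarrow> Q \<subseteq> carrier G \<Longrightarrow> \<exists>A :: nat \<Rightarrow> 'g set. (\<forall>i. A i \<subseteq> carrier G) \<and>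
      (\<forall>i j. i \<noteq> j \<longrightarrow> (\<forall>a\<in>A i. \<forall>b\<in>A j. 1/4 \<le> d a b)) \<and> (\<forall>g\<in>Q. \<forall>i. \<exists>h\<in>B i. h \<otimes> g \<in> A i)"
  shows "\<not> metrizable_space M"
proof
  assume "metrizable_space M"
  define ind :: "nat \<Rightarrow> nat set \<Rightarrow> real" where "ind i S = (if i \<in> S then 0 else 1)" for i S
  \<comment> \<open>The element \<open>h\<close> is chosen before \<open>S\<close>: a single
    translate must take the right values for all sets of colours at once.\<close>
  define Zg where "Zg i g = {F \<in> lipschitz_colourings. \<exists>h\<in>B i. \<forall>S. F (S, h \<otimes> g) = ind i S}" for i g
  define Z where "Z = (\<Inter>p \<in> UNIV \<times> carrier G. Zg (fst p) (snd p))"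
  have closed_Zg: "closedin colour_space (Zg i g)" if g: "g \<in> carrier G" for i g
  proof -
    have "closedin colour_space {F \<in> topspace colour_space. F (S, h \<otimes> g) \<in> {ind i S}}"
      if "h \<in> B i" for h S
      using that g B
      by (intro closedin_continuous_map_preimage[of _ euclideanreal] continuous_map_colour_space_apply) auto
    \<comment> \<open>The union over \<open>h\<close> is closed because \<open>B i\<close> is
      finite.\<close>
    then have "closedin colour_space (lipschitz_colourings \<inter>
       (\<Union>h\<in>B i. \<Inter>S. {F \<in> topspace colour_space. F (S, h \<otimes> g) \<in> {ind i S}}))"
      using B by (intro closedin_Int closedin_lipschitz_colourings closedin_Union closedin_INT) auto
    also have "\<dots> = Zg i g"
      by (auto simp: Zg_def lipschitz_colourings_def)
    finally show ?thesis .
  qed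
  have "Z \<noteq> {}"
  proof -
    have "\<Inter>\<F> \<noteq> {}" if \<F>: "finite \<F>" "\<F> \<subseteq> (\<lambda>p. Zg (fst p) (snd p)) ` (UNIV \<times> carrier G)" for \<F>
    proof -
      obtain P where P: "finite P" "P \<subseteq> UNIV \<times> carrier G" "\<F> = (\<lambda>p. Zg (fst p) (snd p)) ` P"
        using finite_subset_image[OF \<F>] by (elim exE conjE) (rule that)
      then have "finite (snd ` P)" "snd ` P \<subseteq> carrier G" by auto
      from colours[OF this] obtain A :: "nat \<Rightarrow> 'g set"
        where A: "\<And>i. A i \<subseteq> carrier G"
          and sep: "\<And>i j a b. i \<noteq> j \<Longrightarrow> a \<in> A i \<Longrightarrow> b \<in> A j \<Longrightarrow> 1/4 \<le> d a b"
          and hit: "\<And>g i. g \<in> snd ` P \<Longrightarrow> \<exists>h\<in>B i. h \<otimes> g \<in> A i" by metis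
      \<comment> \<open>The infimum is four times the distance from \<open>g\<close> to the colours
        in \<open>S\<close>, cut off at 1. Inserting 1 also keeps the set nonempty when no element
        has a colour in \<open>S\<close>.\<close>
      define D where "D S g = insert 1 ((\<lambda>a. 4 * d g a) ` (\<Union>i\<in>S. A i))" for S g
      define F where "F = restrict (\<lambda>(S, g). Inf (D S g)) (UNIV \<times> carrier G)"
      have D0: "0 \<le> x" if "x \<in> D S g" "g \<in> carrier G" for x S g
        using that subsetD[OF A] d_nonneg by (auto simp: D_def)
      have bdd: "bdd_below (D S g)" if "g \<in> carrier G" for S g
        using D0 that by (intro bdd_belowI[of _ 0]) auto
      have ge: "0 \<le> Inf (D S g)" if "g \<in> carrier G" for S g
        using that D0 by (intro cInf_greatest) (auto simp: D_def)
      have le: "Inf (D S g) \<le> 1" if "g \<in> carrier G" for S g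
        using that bdd by (intro cInf_lower) (auto simp: D_def)
      have lip: "Inf (D S g) \<le> Inf (D S h) + 4 * d g h" if "g \<in> carrier G" "h \<in> carrier G" for S g h
      proof -
        have "Inf (D S g) - 4 * d g h \<le> Inf (D S h)"
        proof (rule cInf_greatest)
          fix x assume "x \<in> D S h"
          then consider "x = 1" | i a where "i \<in> S" "a \<in> A i" "x = 4 * d h a" by (auto simp: D_def)
          then show "Inf (D S g) - 4 * d g h \<le> x"
          proof cases
            case 1 then show ?thesis using le[of g S] that d_nonneg[of g h] by simp
          next
            case 2
            then have "Inf (D S g) \<le> 4 * d g a"
              using that bdd by (intro cInf_lower) (auto simp: D_def)
            then show ?thesis using d_triangle[of g h a] subsetD[OF A 2(2)] 2(3) that by auto
          qed
        qed (auto simp: D_def)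
        then show ?thesis by simp
      qed
      have "F \<in> lipschitz_colourings"
      proof -
        have "\<bar>Inf (D S g) - Inf (D S h)\<bar> \<le> 4 * d g h" if "g \<in> carrier G" "h \<in> carrier G" for S g h
          using lip[of g h S] lip[of h g S] d_commute[of g h] that by auto
        then show ?thesis
          using ge le by (auto simp: lipschitz_colourings_def topspace_colour_space F_def)
      qed
      moreover have "Inf (D S a) = ind i S" if "a \<in> A i" for S a i
      proof (cases "i \<in> S")
        case True
        have a: "a \<in> carrier G" using that A by blast
        then have "4 * d a a \<in> D S a" using True that by (auto simp: D_def)
        then have "Inf (D S a) \<le> 0"
          using bdd[OF a] d_refl[OF a] by (metis cInf_lower mult_zero_right)
        then show ?thesis using ge[OF a, of S] True by (simp add: ind_def)
      next
        case False
        have a: "a \<in> carrier G" using that A by blast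
        have "1 \<le> x" if "x \<in> D S a" for x
          using that False sep[of i _ a] \<open>a \<in> A i\<close> by (force simp: D_def)
        then have "1 \<le> Inf (D S a)" by (intro cInf_greatest) (auto simp: D_def)
        then show ?thesis using le[OF a, of S] False by (simp add: ind_def)
      qed
      ultimately have "F \<in> Zg i g" if "(i, g) \<in> P" for i g
      proof -
        have "g \<in> snd ` P" using that by force
        then obtain h where h: "h \<in> B i" "h \<otimes> g \<in> A i" using hit by blast
        then have "h \<otimes> g \<in> carrier G" using A by blast
        then have "F (S, h \<otimes> g) = ind i S" for S
          using \<open>\<And>S a i. a \<in> A i \<Longrightarrow> Inf (D S a) = ind i S\<close>[OF h(2)] by (simp add: F_def)
        then show ?thesis using h(1) \<open>F \<in> lipschitz_colourings\<close> unfolding Zg_def by blast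
      qed
      then have "F \<in> \<Inter>\<F>" unfolding P(3) by simp
      then show ?thesis by blast
    qed
    moreover have "closedin colour_space C" if "C \<in> (\<lambda>p. Zg (fst p) (snd p)) ` (UNIV \<times> carrier G)" for C
      using that closed_Zg by auto
    ultimately have "\<Inter>((\<lambda>p. Zg (fst p) (snd p)) ` (UNIV \<times> carrier G)) \<noteq> {}"
      by (intro compact_colour_space[unfolded compact_space_fip, rule_format]) blast
    then show ?thesis by (simp add: Z_def)
  qed
  have closed_Z: "closedin colour_space Z"
    unfolding Z_def using closed_Zg one_closed by (intro closedin_INT) auto
  have Z_iff: "F \<in> Z \<longleftrightarrow> (\<forall>i. \<forall>g\<in>carrier G. F \<in> Zg i g)" for F
    by (auto simp: Z_def)
  have Z_lip: "Z \<subseteq> lipschitz_colourings"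
  proof
    fix F assume "F \<in> Z"
    then have "F \<in> Zg 0 \<one>" using Z_iff one_closed by blast
    then show "F \<in> lipschitz_colourings" by (simp add: Zg_def)
  qed
  have "translate k F \<in> Z" if k: "k \<in> carrier G" and F: "F \<in> Z" for k F
  proof -
    have "\<exists>h\<in>B i. \<forall>S. translate k F (S, h \<otimes> g) = ind i S" if g: "g \<in> carrier G" for i g
    proof -
      \<comment> \<open>Since \<open>Z\<close> imposes its condition at every group element,
        invariance is the same condition read at \<open>g \<otimes> k\<close>.\<close>
      have "F \<in> Zg i (g \<otimes> k)" using F g k by (simp add: Z_iff)
      then obtain h where "h \<in> B i" "\<And>S. F (S, h \<otimes> (g \<otimes> k)) = ind i S" by (auto simp: Zg_def)
      moreover have "h \<in> carrier G" using B \<open>h \<in> B i\<close> by auto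
      ultimately show ?thesis using g k by (intro bexI[of _ h]) (auto simp: m_assoc)
    qed
    then show ?thesis
      using translate_lipschitz[OF k, of F] F Z_lip by (auto simp: Z_iff Zg_def)
  qed
  with closed_Z Z_lip have fl: "flow G T (subtopology colour_space Z) (\<lambda>h. restrict (translate h) Z)"
    by (rule flow_translate)
  have tZ: "topspace (subtopology colour_space Z) = Z"
    using closed_Z closedin_subset by fastforce
  obtain Y where Y: "Y \<subseteq> Z" and mY: "minimal_flow G T (subtopology (subtopology colour_space Z) Y)
      (\<lambda>h. restrict (restrict (translate h) Z) Y)"
    using minimal_subflow_exists[OF fl _ topspace_T] \<open>Z \<noteq> {}\<close> unfolding tZ by metis
  let ?Y = "subtopology (subtopology colour_space Z) Y"
  have tY: "topspace ?Y = Y" using Y tZ by auto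
  obtain f where f: "factor_map G M \<phi> ?Y (\<lambda>h. restrict (restrict (translate h) Z) Y) f"
    using universal_minimal_flow_factor_map[OF umf mY] by blast
  then have fc: "continuous_map M ?Y f" and fs: "f ` topspace M = Y"
    unfolding factor_map_def tY by blast+
  obtain F where F: "F \<in> Y" using mY unfolding minimal_flow_def tY by blast
  \<comment> \<open>The condition at \<open>\<one>\<close> yields \<open>h\<close> in
    \<open>B i\<close>. The translate of \<open>F\<close> by \<open>h\<close> stays in the minimal
    flow, takes the value \<open>F (S, h)\<close> at \<open>\<one>\<close>, and lifts to
    \<open>M\<close> by surjectivity of \<open>f\<close>.\<close>
  have "\<exists>m\<in>topspace M. \<forall>S. f m (S, \<one>) = ind i S" for i
  proof -
    have "F \<in> Zg i \<one>" using F Y one_closed Z_iff by blast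
    then obtain h where h: "h \<in> B i" "\<And>S. F (S, h \<otimes> \<one>) = ind i S" by (auto simp: Zg_def)
    have hG: "h \<in> carrier G" using B h by auto
    have "group_action G Y (\<lambda>h. restrict (restrict (translate h) Z) Y)"
      using mY unfolding minimal_flow_def flow_def tY by blast
    from group_action.element_image[OF this hG F] F Y have "translate h F \<in> Y" by auto
    then obtain m where "m \<in> topspace M" "f m = translate h F" using fs by (metis imageE)
    then show ?thesis using h hG by (intro bexI[of _ m]) auto
  qed
  then obtain m where m: "\<And>i. m i \<in> topspace M" "\<And>i S. f (m i) (S, \<one>) = ind i S" by metis
  obtain U \<delta> where "Metric_space U \<delta>" and M: "M = Metric_space.mtopology U \<delta>"
    using \<open>metrizable_space M\<close> by (auto simp: metrizable_space_def)
  interpret U: Metric_space U \<delta> by fact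
  have "compact_space U.mtopology"
    using umf M by (auto simp: universal_minimal_flow_def minimal_flow_def flow_def)
  moreover have "range m \<subseteq> U" using m(1) M by auto
  ultimately obtain l r where l: "l \<in> U" "strict_mono (r :: nat \<Rightarrow> nat)"
      "limitin U.mtopology (m \<circ> r) l sequentially"
    unfolding U.compact_space_sequentially by blast
  \<comment> \<open>All sets of colours are available as indices, so \<open>S\<close> may be chosen
    after the subsequence; the coordinate at \<open>S\<close> then alternates between 0 and
    1.\<close>
  define S where "S = r ` {n. even n}"
  have "continuous_map ?Y euclideanreal (\<lambda>F. F (S, \<one>))"
    by (intro continuous_map_from_subtopology continuous_map_colour_space_apply one_closed)
  then have "continuous_map M euclideanreal (\<lambda>x. f x (S, \<one>))"
    using continuous_map_compose[OF fc] by (simp add: comp_def)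
  then have "limitin euclideanreal ((\<lambda>x. f x (S, \<one>)) \<circ> (m \<circ> r)) (f l (S, \<one>)) sequentially"
    using l(3)[folded M] by (rule continuous_map_limit)
  then have lim: "(\<lambda>n. ind (r n) S) \<longlonglongrightarrow> f l (S, \<one>)" by (simp add: comp_def m(2))
  have "inj r" using l(2) by (rule strict_mono_imp_inj_on)
  then have ind: "ind (r n) S = (if even n then 0 else 1)" for n
    by (auto simp: ind_def S_def inj_image_mem_iff)
  have "(\<lambda>n. ind (r (2 * n)) S) \<longlonglongrightarrow> f l (S, \<one>)" "(\<lambda>n. ind (r (2 * n + 1)) S) \<longlonglongrightarrow> f l (S, \<one>)"
    using LIMSEQ_subseq_LIMSEQ[OF lim, of "\<lambda>n. 2 * n"] LIMSEQ_subseq_LIMSEQ[OF lim, of "\<lambda>n. 2 * n + 1"]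
    by (auto simp: strict_mono_def comp_def)
  then have "f l (S, \<one>) = 0" "f l (S, \<one>) = 1"
    unfolding ind by (auto simp: LIMSEQ_const_iff)
  then show False by simp
qed

end


section \<open>Paths and homeomorphism groups\<close>

text \<open>Take for \<open>t\<close> the infimum of the closed set of times spent outside
  \<open>U\<close>. All earlier points lie in \<open>U\<close>, so the exit point lies in its
  closure.\<close>

lemma path_first_exit:
  assumes \<alpha>: "pathin X \<alpha>" and U: "openin X U" and 0: "\<alpha> 0 \<in> U" and s: "s \<in> {0..1}" "\<alpha> s \<notin> U"
  obtains t where "t \<in> {0..1}" "\<alpha> t \<in> X closure_of U - U" "\<And>s. s \<in> {0..t} \<Longrightarrow> \<alpha> s \<in> X closure_of U"
proof -
  have cont: "continuous_map (top_of_set {0..1}) X \<alpha>" using \<alpha> by (simp add: pathin_def)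
  define E where "E = {s \<in> {0..1}. \<alpha> s \<in> topspace X - U}"
  have "closedin (top_of_set {0..1}) {s \<in> topspace (top_of_set {0..1}). \<alpha> s \<in> topspace X - U}"
    using U by (intro closedin_continuous_map_preimage[OF cont] closedin_diff) auto
  then have "closed E" by (simp add: E_def closedin_closed_eq)
  moreover have "s \<in> E" using s path_image_subset_topspace[OF \<alpha>] by (auto simp: E_def)
  moreover have bdd: "bdd_below E" by (auto simp: E_def intro: bdd_belowI[of _ 0])
  ultimately have "Inf E \<in> E" by (intro closed_contains_Inf) auto
  define t where "t = Inf E"
  have t: "t \<in> {0..1}" "\<alpha> t \<notin> U" "\<alpha> t \<in> topspace X" using \<open>Inf E \<in> E\<close> by (auto simp: t_def E_def)
  have before: "\<alpha> s \<in> U" if "s \<in> {0..<t}" for s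
  proof (rule ccontr)
    assume "\<alpha> s \<notin> U"
    then have "s \<in> E" using that t path_image_subset_topspace[OF \<alpha>] by (auto simp: E_def)
    then have "t \<le> s" unfolding t_def using bdd by (rule cInf_lower)
    with that show False by simp
  qed
  \<comment> \<open>Positivity of \<open>t\<close> ensures that the closure of
    \<open>{0..<t}\<close> is \<open>{0..t}\<close>.\<close>
  have "t \<noteq> 0" using 0 t by auto
  have U_cl: "U \<subseteq> X closure_of U" using openin_subset[OF U] by (rule closure_of_subset)
  define C where "C = {s \<in> {0..1}. \<alpha> s \<in> X closure_of U}"
  have "closedin (top_of_set {0..1}) {s \<in> topspace (top_of_set {0..1}). \<alpha> s \<in> X closure_of U}"
    by (intro closedin_continuous_map_preimage[OF cont]) auto
  then have "closed C" by (simp add: C_def closedin_closed_eq)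
  moreover have "{0..<t} \<subseteq> C" using before t U_cl by (auto simp: C_def)
  ultimately have "closure {0..<t} \<subseteq> C" by (rule closure_minimal[rotated])
  then have "{0..t} \<subseteq> C" using \<open>t \<noteq> 0\<close> t by simp
  then have "\<alpha> s \<in> X closure_of U" if "s \<in> {0..t}" for s using that by (auto simp: C_def)
  moreover from this[of t] have "\<alpha> t \<in> X closure_of U - U" using t by auto
  ultimately show thesis using t(1) by (intro that[of t])
qed

text \<open>Induction on the set, appending at each step a path to the new point. It provides one
  path that serves finitely many group elements simultaneously.\<close>

lemma path_through_finite_set:
  assumes X: "path_connected_space X" "topspace X \<noteq> {}" and "finite P" "P \<subseteq> topspace X"
  obtains \<beta> where "pathin X \<beta>" "P \<subseteq> \<beta> ` {0..1}"
  using \<open>finite P\<close> \<open>P \<subseteq> topspace X\<close>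
proof (induction P arbitrary: thesis rule: finite_induct)
  case empty
  obtain x where "x \<in> topspace X" using X by blast
  then show ?case using empty(1)[of "\<lambda>_. x"] by simp
next
  case (insert p P)
  then obtain \<beta> where \<beta>: "pathin X \<beta>" "P \<subseteq> \<beta> ` {0..1}" by auto
  have "\<beta> 1 \<in> topspace X" using \<beta> path_finish_in_topspace by blast
  then obtain \<gamma> where \<gamma>: "pathin X \<gamma>" "\<gamma> 0 = \<beta> 1" "\<gamma> 1 = p"
    using X insert.prems unfolding path_connected_space_def by blast
  define \<delta> where "\<delta> t = (if t \<le> 1/2 then \<beta> (2 * t) else \<gamma> (2 * t - 1))" for t :: real
  have "continuous_map (top_of_set {0..1}) X (\<lambda>t. if t \<le> 1/2 then (\<beta> \<circ> (\<lambda>t. 2 * t)) t else (\<gamma> \<circ> (\<lambda>t. 2 * t - 1)) t)"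
  proof (rule continuous_map_cases_le)
    show "continuous_map (subtopology (top_of_set {0..1}) {x \<in> topspace (top_of_set {0..1}). x \<le> 1/2}) X
        (\<beta> \<circ> (\<lambda>t. 2 * t))"
    proof (rule continuous_map_compose)
      show "continuous_map (subtopology (top_of_set {0..1}) {x \<in> topspace (top_of_set {0..1}). x \<le> 1/2})
        (top_of_set {0..1}) (\<lambda>t::real. 2 * t)"
        by (auto simp: subtopology_subtopology intro!: continuous_intros)
    qed (use \<beta> in \<open>simp add: pathin_def\<close>)
    show "continuous_map (subtopology (top_of_set {0..1}) {x \<in> topspace (top_of_set {0..1}). 1/2 \<le> x}) X
        (\<gamma> \<circ> (\<lambda>t. 2 * t - 1))"
    proof (rule continuous_map_compose)
      show "continuous_map (subtopology (top_of_set {0..1}) {x \<in> topspace (top_of_set {0..1}). 1/2 \<le> x})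
        (top_of_set {0..1}) (\<lambda>t::real. 2 * t - 1)"
        by (auto simp: subtopology_subtopology intro!: continuous_intros)
    qed (use \<gamma> in \<open>simp add: pathin_def\<close>)
    show "(\<beta> \<circ> (\<lambda>t. 2 * t)) t = (\<gamma> \<circ> (\<lambda>t. 2 * t - 1)) t"
      if "t \<in> topspace (top_of_set {0..1})" "t = 1/2" for t
      unfolding that(2) using \<gamma> by simp
  qed (auto intro!: continuous_intros)
  then have "pathin X \<delta>" unfolding pathin_def \<delta>_def comp_def .
  moreover have "insert p P \<subseteq> \<delta> ` {0..1}"
  proof
    fix x assume "x \<in> insert p P"
    then consider "x = p" | t where "t \<in> {0..1}" "x = \<beta> t" using \<beta> by blast
    then show "x \<in> \<delta> ` {0..1}"
    proof cases
      case 1 then show ?thesis using \<gamma> by (intro image_eqI[of _ _ 1]) (auto simp: \<delta>_def)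
    next
      case 2 then show ?thesis by (intro image_eqI[of _ _ "t/2"]) (auto simp: \<delta>_def)
    qed
  qed
  ultimately show ?case by (rule insert.prems(1))
qed

section \<open>Groups of homeomorphisms and their rigid stabilizers\<close>

lemma carrier_Homeo_subset_Bij: "carrier (Homeo X) \<subseteq> Bij (topspace X)"
proof
  fix g assume "g \<in> carrier (Homeo X)"
  then have g: "g \<in> extensional (topspace X)" "homeomorphic_map X X g" by (auto simp: Homeo_def)
  from g(2) have "inj_on g (topspace X)" "g ` topspace X = topspace X"
    by (rule homeomorphic_imp_injective_map, rule homeomorphic_imp_surjective_map)
  with g(1) show "g \<in> Bij (topspace X)" by (simp add: Bij_def bij_betw_def)
qed

text \<open>Homeomorphisms form a subgroup of \<open>BijGroup\<close>: on the space, the normalised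
  inverse agrees with the continuous one.\<close>

lemma group_Homeo: "group (Homeo X)"
proof -
  let ?S = "topspace X" and ?H = "{g \<in> extensional (topspace X). homeomorphic_map X X g}"
  interpret B: group "BijGroup ?S" by (rule group_BijGroup)
  have sub: "?H \<subseteq> Bij ?S"
    using carrier_Homeo_subset_Bij[of X] by (simp add: Homeo_def)
  have "subgroup ?H (BijGroup ?S)"
  proof (rule B.subgroupI)
    show "?H \<subseteq> carrier (BijGroup ?S)" using sub by (simp add: BijGroup_def)
    have "homeomorphic_map X X (\<lambda>x\<in>?S. x)"
      by (rule homeomorphic_map_eq[OF homeomorphic_map_id[THEN iffD2]]) auto
    then show "?H \<noteq> {}" by force
    fix g assume g: "g \<in> ?H"
    then have gB: "g \<in> Bij ?S" using sub by blast
    obtain k where k: "homeomorphic_maps X X g k" using g homeomorphic_map_maps by blast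
    have "homeomorphic_map X X k"
      using k homeomorphic_maps_sym homeomorphic_maps_map by metis
    moreover have "k x = restrict (inv_into ?S g) ?S x" if x: "x \<in> ?S" for x
    proof -
      have "k x \<in> ?S" "g (k x) = x"
        using k x by (auto simp: homeomorphic_maps_def continuous_map_def)
      moreover have "inj_on g ?S" using gB by (simp add: Bij_def bij_betw_def)
      ultimately show ?thesis using inv_into_f_eq[of g ?S "k x" x] x by simp
    qed
    ultimately have "homeomorphic_map X X (restrict (inv_into ?S g) ?S)"
      by (rule homeomorphic_map_eq)
    then show "inv\<^bsub>BijGroup ?S\<^esub> g \<in> ?H" using gB by (simp add: inv_BijGroup)
  next
    fix g h assume gh: "g \<in> ?H" "h \<in> ?H"
    then have "homeomorphic_map X X (g \<circ> h)" by (auto intro: homeomorphic_map_compose)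
    then have "homeomorphic_map X X (compose ?S g h)"
      by (rule homeomorphic_map_eq) (simp add: compose_def)
    then show "g \<otimes>\<^bsub>BijGroup ?S\<^esub> h \<in> ?H"
      using gh sub by (auto simp: BijGroup_def subset_iff)
  qed
  from subgroup.subgroup_is_group[OF this group_BijGroup] show ?thesis
    by (simp add: Homeo_def)
qed

locale homeomorphism_group =
  fixes X :: "'a topology" and G :: "('a \<Rightarrow> 'a) set"
  assumes subgroup_Homeo: "subgroup G (Homeo X)"
begin

sublocale group "Homeo X\<lparr>carrier := G\<rparr>"
  using subgroup_Homeo group_Homeo by (rule subgroup.subgroup_is_group)

lemma homeomorphic: "g \<in> G \<Longrightarrow> homeomorphic_map X X g"
  using subgroup.subset[OF subgroup_Homeo] by (auto simp: Homeo_def)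

lemma continuous: "g \<in> G \<Longrightarrow> continuous_map X X g"
  using homeomorphic homeomorphic_imp_continuous_map by blast

lemma closed_apply: "g \<in> G \<Longrightarrow> x \<in> topspace X \<Longrightarrow> g x \<in> topspace X"
  using continuous by (auto simp: continuous_map_def)

lemma in_Bij: "g \<in> G \<Longrightarrow> g \<in> Bij (topspace X)"
  using subgroup.subset[OF subgroup_Homeo] carrier_Homeo_subset_Bij by blast

lemma inj: "g \<in> G \<Longrightarrow> x \<in> topspace X \<Longrightarrow> y \<in> topspace X \<Longrightarrow> g x = g y \<Longrightarrow> x = y"
  using in_Bij by (auto simp: Bij_def bij_betw_def inj_on_def)

lemma surj:
  assumes "g \<in> G" "y \<in> topspace X" obtains x where "x \<in> topspace X" "g x = y"
proof -
  have "g ` topspace X = topspace X"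
    using assms homeomorphic_imp_surjective_map[OF homeomorphic] by blast
  then have "y \<in> g ` topspace X" using assms(2) by simp
  then show thesis using that by (elim imageE) simp
qed

lemma mult_closed: "g \<in> G \<Longrightarrow> h \<in> G \<Longrightarrow> g \<otimes>\<^bsub>Homeo X\<^esub> h \<in> G"
  using m_closed by simp

lemma mult_apply: "g \<in> G \<Longrightarrow> h \<in> G \<Longrightarrow> x \<in> topspace X \<Longrightarrow> (g \<otimes>\<^bsub>Homeo X\<^esub> h) x = g (h x)"
  using in_Bij by (simp add: Homeo_def BijGroup_def compose_def)

lemma inverse:
  assumes "g \<in> G" obtains h where "h \<in> G" "\<And>x. x \<in> topspace X \<Longrightarrow> h (g x) = x"
proof -
  let ?h = "inv\<^bsub>Homeo X\<lparr>carrier := G\<rparr>\<^esub> g"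
  have h: "?h \<in> G" "?h \<otimes>\<^bsub>Homeo X\<^esub> g = \<one>\<^bsub>Homeo X\<^esub>"
    using assms inv_closed[of g] l_inv[of g] by simp_all
  have "?h (g x) = x" if "x \<in> topspace X" for x
    using mult_apply[OF h(1) assms that] h(2) that by (simp add: Homeo_def BijGroup_def)
  with h(1) show thesis by (rule that)
qed

lemma one_in: "(\<lambda>x\<in>topspace X. x) \<in> G"
  using one_closed by (simp add: Homeo_def BijGroup_def)

text \<open>If \<open>h x\<close> were outside \<open>U\<close>, then \<open>h\<close> would fix it,
  so \<open>x\<close> and \<open>h x\<close> would have the same image, against injectivity.\<close>

lemma rigid_stabilizer_mem:
  assumes "h \<in> rigid_stabilizer X G U" "U \<subseteq> topspace X" "x \<in> U" shows "h x \<in> U"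
proof (rule ccontr)
  assume "h x \<notin> U"
  have h: "h \<in> G" "\<And>x. x \<in> topspace X - U \<Longrightarrow> h x = x" using assms(1) by (auto simp: rigid_stabilizer_def)
  have "x \<in> topspace X" using assms by auto
  then have "h x \<in> topspace X" using h closed_apply by blast
  then have "h (h x) = h x" using h \<open>h x \<notin> U\<close> by auto
  then have "h x = x" using inj[OF h(1)] \<open>x \<in> topspace X\<close> \<open>h x \<in> topspace X\<close> by blast
  with \<open>h x \<notin> U\<close> \<open>x \<in> U\<close> show False by simp
qed

text \<open>Local transitivity makes the orbits of the rigid stabilizer in \<open>W\<close> open.
  They partition the connected set \<open>W\<close>, so there is only one.\<close>

lemma rigid_stabilizer_transitive:
  assumes lt: "locally_transitive X G" and W: "openin X W" "connectedin X W"
    and xy: "x \<in> W" "y \<in> W"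
  obtains h where "h \<in> rigid_stabilizer X G W" "h x = y"
proof -
  let ?R = "rigid_stabilizer X G W"
  define Orb where "Orb x = (\<lambda>h. h x) ` ?R" for x
  have WX: "W \<subseteq> topspace X" using W openin_subset by blast
  have OW: "Orb x \<subseteq> W" if "x \<in> W" for x
    using that WX rigid_stabilizer_mem by (auto simp: Orb_def)
  have refl: "x \<in> Orb x" if "x \<in> W" for x
    using one_in that WX
    by (auto simp: Orb_def rigid_stabilizer_def intro!: image_eqI[of _ _ "\<lambda>x\<in>topspace X. x"])
  have trans: "z \<in> Orb x" if x: "x \<in> W" and y: "y \<in> Orb x" and z: "z \<in> Orb y" for x y z
  proof -
    obtain g h where g: "g \<in> ?R" "y = g x" and h: "h \<in> ?R" "z = h y" using y z by (auto simp: Orb_def)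
    have "h \<otimes>\<^bsub>Homeo X\<^esub> g \<in> ?R"
      using g h mult_closed[of h g] mult_apply[of h g] by (auto simp: rigid_stabilizer_def)
    moreover have "(h \<otimes>\<^bsub>Homeo X\<^esub> g) x = z"
      using g h x WX mult_apply[of h g x] by (auto simp: rigid_stabilizer_def)
    ultimately show ?thesis unfolding Orb_def by force
  qed
  have sym: "x \<in> Orb y" if x: "x \<in> W" and y: "y \<in> Orb x" for x y
  proof -
    obtain g where g: "g \<in> ?R" "y = g x" using y by (auto simp: Orb_def)
    then have "g \<in> G" by (simp add: rigid_stabilizer_def)
    then obtain h where h: "h \<in> G" "\<And>x. x \<in> topspace X \<Longrightarrow> h (g x) = x" using inverse by metis
    have "h z = z" if "z \<in> topspace X - W" for z
      using h(2)[of z] g(1) that by (simp add: rigid_stabilizer_def)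
    then have "h \<in> ?R" using h by (simp add: rigid_stabilizer_def)
    moreover have "h y = x" using h(2)[of x] g x WX by auto
    ultimately show ?thesis unfolding Orb_def by force
  qed
  have "openin X (Orb x)" if x: "x \<in> W" for x
  proof (subst openin_subopen, intro ballI)
    fix z assume z: "z \<in> Orb x"
    then have "z \<in> W" using OW x by blast
    then obtain V where "openin X V" "z \<in> V" "V \<subseteq> {g z | g. g \<in> ?R}"
      using lt W unfolding locally_transitive_def by meson
    moreover have "{g z | g. g \<in> ?R} = Orb z" by (auto simp: Orb_def)
    ultimately show "\<exists>V. openin X V \<and> z \<in> V \<and> V \<subseteq> Orb x" using trans[OF x z] by blast
  qed
  then have opn: "openin X (Orb x)" "openin X (\<Union>z\<in>W - Orb x. Orb z)" using xy by auto
  have disj: "Orb x \<inter> (\<Union>z\<in>W - Orb x. Orb z) = {}"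
    using sym trans xy OW by blast
  have cover: "W \<subseteq> Orb x \<union> (\<Union>z\<in>W - Orb x. Orb z)" using refl by blast
  have "(\<Union>z\<in>W - Orb x. Orb z) \<inter> W = {}"
    using W(2) opn disj cover refl[OF xy(1)] xy(1) unfolding connectedin by blast
  then have "y \<in> Orb x" using cover xy by blast
  then show thesis using that by (auto simp: Orb_def)
qed

text \<open>The preimages of \<open>U\<close> under \<open>R\<close> form an open cover of the
  compact set \<open>S\<close>. This turns transitivity into finitely many group elements.\<close>

lemma finite_translates_into_open:
  assumes S: "compactin X S" and U: "openin X U" and R: "R \<subseteq> G"
    and hit: "\<And>x. x \<in> S \<Longrightarrow> \<exists>g\<in>R. g x \<in> U"
  shows "\<exists>F. finite F \<and> F \<subseteq> R \<and> (\<forall>x\<in>S. \<exists>g\<in>F. g x \<in> U)"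
proof -
  let ?N = "\<lambda>g. {x \<in> topspace X. g x \<in> U}"
  have "openin X N" if "N \<in> ?N ` R" for N
    using that R U continuous by (auto intro: openin_continuous_map_preimage)
  moreover have "S \<subseteq> \<Union>(?N ` R)"
    using hit compactin_subset_topspace[OF S] by blast
  ultimately obtain \<F> where \<F>: "finite \<F>" "\<F> \<subseteq> ?N ` R" "S \<subseteq> \<Union>\<F>"
    using compactinD[OF S, of "?N ` R"] by auto
  obtain F where F: "F \<subseteq> R" "finite F" "\<F> = ?N ` F"
    using finite_subset_image[OF \<F>(1,2)] by auto
  have "\<exists>g\<in>F. g x \<in> U" if "x \<in> S" for x using that \<F>(3) unfolding F(3) by auto
  with F(1,2) show ?thesis by blast
qed

end

section \<open>Uniform distance and the compact-open topology\<close>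

lemma compact_open_uniformly_close:
  fixes f :: "'a \<Rightarrow> 'b::metric_space"
  assumes X: "compact_space X" and f: "continuous_map X euclidean f"
    and h: "h \<in> carrier (Homeo X)" and e: "0 < e"
  obtains N where "openin (compact_open_topology X) N" "h \<in> N"
    "\<And>k x. k \<in> N \<Longrightarrow> x \<in> topspace X \<Longrightarrow> dist (f (k x)) (f (h x)) < e"
proof -
  have hc: "continuous_map X X h"
    using h homeomorphic_imp_continuous_map by (auto simp: Homeo_def)
  have fh: "continuous_map X euclidean (\<lambda>x. f (h x))"
    using continuous_map_compose[OF hc f] by (simp add: comp_def)
  \<comment> \<open>On \<open>K x\<close> the map \<open>f \<circ> h\<close> stays within
    \<open>e/4\<close> of \<open>f (h x)\<close>, and finitely many of the smaller open sets
    \<open>O' x\<close> cover \<open>X\<close>. Maps taking these \<open>K x\<close> into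
    \<open>U x\<close> are off by less than \<open>e/2 + e/4\<close>.\<close>
  define K where "K x = {z \<in> topspace X. f (h z) \<in> cball (f (h x)) (e/4)}" for x
  define O' where "O' x = {z \<in> topspace X. f (h z) \<in> ball (f (h x)) (e/4)}" for x
  define U where "U x = {z \<in> topspace X. f z \<in> ball (f (h x)) (e/2)}" for x
  define B where "B x = {g \<in> carrier (Homeo X). g ` K x \<subseteq> U x}" for x
  have "openin X (O' x)" for x
    unfolding O'_def using fh by (rule openin_continuous_map_preimage) simp
  moreover have "topspace X \<subseteq> \<Union>(O' ` topspace X)" using e by (auto simp: O'_def)
  ultimately obtain \<F> where \<F>: "finite \<F>" "\<F> \<subseteq> O' ` topspace X" "topspace X \<subseteq> \<Union>\<F>"
    using compactinD[OF X[unfolded compact_space_def], of "O' ` topspace X"] by auto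
  obtain P where P: "P \<subseteq> topspace X" "finite P" "topspace X \<subseteq> (\<Union>x\<in>P. O' x)"
    using finite_subset_image[OF \<F>(1,2)] \<F>(3) by auto
  have B_open: "openin (compact_open_topology X) (B x)" for x
  proof -
    have "closedin X (K x)"
      unfolding K_def using fh by (rule closedin_continuous_map_preimage) simp
    then have "compactin X (K x)" using X closedin_compact_space by blast
    moreover have "openin X (U x)"
      unfolding U_def using f by (rule openin_continuous_map_preimage) simp
    ultimately show ?thesis
      unfolding compact_open_topology_def B_def by (intro topology_generated_by_Basis) blast
  qed
  have hB: "h \<in> B x" for x
    using h e hc by (auto simp: B_def K_def U_def continuous_map_def dist_commute)
  \<comment> \<open>The carrier is itself a subbasic set; intersecting with it covers the case that
    \<open>P\<close> is empty.\<close>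
  have "carrier (Homeo X) = {g \<in> carrier (Homeo X). g ` {} \<subseteq> {}}" by auto
  then have "openin (compact_open_topology X) (carrier (Homeo X))"
    unfolding compact_open_topology_def
    by (intro topology_generated_by_Basis CollectI exI[of _ "{}"]) auto
  then have opn: "openin (compact_open_topology X) (carrier (Homeo X) \<inter> (\<Inter>x\<in>P. B x))"
    using P(2) B_open by (cases "P = {}") (auto intro!: openin_Int openin_INT2)
  have near: "dist (f (k x)) (f (h x)) < e" if k: "k \<in> carrier (Homeo X) \<inter> (\<Inter>x\<in>P. B x)" and x: "x \<in> topspace X" for k x
  proof -
    obtain p where p: "p \<in> P" "x \<in> O' p" using P(3) x by blast
    then have "x \<in> K p" by (auto simp: O'_def K_def)
    then have "k x \<in> U p" using k p by (auto simp: B_def)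
    then have "dist (f (h p)) (f (k x)) < e/2" by (simp add: U_def)
    moreover have "dist (f (h p)) (f (h x)) < e/4" using p by (simp add: O'_def)
    ultimately have "dist (f (k x)) (f (h x)) < e/2 + e/4"
      using dist_triangle[of "f (k x)" "f (h x)" "f (h p)"] by (simp add: dist_commute)
    then show ?thesis using e by simp
  qed
  show thesis using opn _ near by (rule that) (use h hB in auto)
qed

lemma topspace_compact_open_topology: "topspace (compact_open_topology X) = carrier (Homeo X)"
proof -
  have "{g \<in> carrier (Homeo X). g ` {} \<subseteq> {}} \<in>
      {{g \<in> carrier (Homeo X). g ` K \<subseteq> U} | K U. compactin X K \<and> openin X U}"
    by (intro CollectI exI[of _ "{}"]) auto
  then show ?thesis
    unfolding compact_open_topology_def topology_generated_by_topspace by blast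
qed

context homeomorphism_group
begin

text \<open>A right factor only reparametrises \<open>X\<close>, by surjectivity, and leaves the
  supremum unchanged. A common left factor \<open>g\<close> replaces \<open>f\<close> by the
  continuous map \<open>f \<circ> g\<close>, to which uniform closeness applies as well.\<close>

lemma sup_pseudometric:
  fixes f :: "'a \<Rightarrow> 'b::metric_space"
  assumes X: "compact_space X" "topspace X \<noteq> {}" and f: "continuous_map X euclidean f"
  defines "d \<equiv> \<lambda>g h. SUP x\<in>topspace X. dist (f (g x)) (f (h x))"
  shows "right_invariant_pseudometric (Homeo X\<lparr>carrier := G\<rparr>)
      (subtopology (compact_open_topology X) G) d"
    and "\<And>g h x. g \<in> G \<Longrightarrow> h \<in> G \<Longrightarrow> x \<in> topspace X \<Longrightarrow> dist (f (g x)) (f (h x)) \<le> d g h"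
proof -
  have "compact (f ` topspace X)"
    using image_compactin[OF X(1)[unfolded compact_space_def] f] by simp
  then have "bounded (f ` topspace X)" by (rule compact_imp_bounded)
  then obtain C where C: "\<And>x y. x \<in> topspace X \<Longrightarrow> y \<in> topspace X \<Longrightarrow> dist (f x) (f y) \<le> C"
    unfolding bounded_two_points by blast
  have upper: "dist (f (g x)) (f (h x)) \<le> d g h" if "g \<in> G" "h \<in> G" "x \<in> topspace X" for g h x
    unfolding d_def using that C closed_apply
    by (intro cSUP_upper bdd_aboveI2[of _ _ C]) auto
  then show "\<And>g h x. g \<in> G \<Longrightarrow> h \<in> G \<Longrightarrow> x \<in> topspace X \<Longrightarrow> dist (f (g x)) (f (h x)) \<le> d g h" .
  have least: "d g h \<le> c" if "\<And>x. x \<in> topspace X \<Longrightarrow> dist (f (g x)) (f (h x)) \<le> c" for g h c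
    unfolding d_def using that X by (intro cSUP_least) auto
  show "right_invariant_pseudometric (Homeo X\<lparr>carrier := G\<rparr>) (subtopology (compact_open_topology X) G) d"
  proof (intro_locales, unfold_locales)
    have "G \<subseteq> carrier (Homeo X)" by (rule subgroup.subset[OF subgroup_Homeo])
    then show "topspace (subtopology (compact_open_topology X) G) = carrier (Homeo X\<lparr>carrier := G\<rparr>)"
      by (simp add: topspace_compact_open_topology inf.absorb2)
    show "d g g = 0" for g
      unfolding d_def using X by simp
    show "d g h = d h g" for g h
      by (simp add: d_def dist_commute)
    show "d g k \<le> d g h + d h k"
      if "g \<in> carrier (Homeo X\<lparr>carrier := G\<rparr>)" "h \<in> carrier (Homeo X\<lparr>carrier := G\<rparr>)"
        "k \<in> carrier (Homeo X\<lparr>carrier := G\<rparr>)" for g h k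
      using that upper by (intro least order_trans[OF dist_triangle add_mono]) auto
    show "d (g \<otimes>\<^bsub>Homeo X\<lparr>carrier := G\<rparr>\<^esub> k) (h \<otimes>\<^bsub>Homeo X\<lparr>carrier := G\<rparr>\<^esub> k) = d g h"
      if "g \<in> carrier (Homeo X\<lparr>carrier := G\<rparr>)" "h \<in> carrier (Homeo X\<lparr>carrier := G\<rparr>)"
        "k \<in> carrier (Homeo X\<lparr>carrier := G\<rparr>)" for g h k
    proof -
      have gk: "g \<in> G" "h \<in> G" "k \<in> G" using that by auto
      have "d (g \<otimes>\<^bsub>Homeo X\<^esub> k) (h \<otimes>\<^bsub>Homeo X\<^esub> k) \<le> d g h"
        using gk upper closed_apply by (intro least) (simp add: mult_apply)
      moreover have "d g h \<le> d (g \<otimes>\<^bsub>Homeo X\<^esub> k) (h \<otimes>\<^bsub>Homeo X\<^esub> k)"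
      proof (rule least)
        fix y assume "y \<in> topspace X"
        then obtain x where x: "x \<in> topspace X" "k x = y" using surj[OF gk(3)] by blast
        then show "dist (f (g y)) (f (h y)) \<le> d (g \<otimes>\<^bsub>Homeo X\<^esub> k) (h \<otimes>\<^bsub>Homeo X\<^esub> k)"
          using upper[OF mult_closed[OF gk(1,3)] mult_closed[OF gk(2,3)] x(1)] gk
          by (simp add: mult_apply)
      qed
      ultimately show ?thesis by simp
    qed
    show "\<exists>N. openin (subtopology (compact_open_topology X) G) N \<and> h \<in> N \<and>
        (\<forall>k\<in>N. d (g \<otimes>\<^bsub>Homeo X\<lparr>carrier := G\<rparr>\<^esub> k) (g \<otimes>\<^bsub>Homeo X\<lparr>carrier := G\<rparr>\<^esub> h) < e)"
      if "g \<in> carrier (Homeo X\<lparr>carrier := G\<rparr>)" "h \<in> carrier (Homeo X\<lparr>carrier := G\<rparr>)" "0 < e" for g h e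
    proof -
      have gh: "g \<in> G" "h \<in> G" using that by auto
      have "continuous_map X euclidean (f \<circ> g)"
        using continuous[OF gh(1)] f by (rule continuous_map_compose)
      moreover have "h \<in> carrier (Homeo X)" using gh subgroup.subset[OF subgroup_Homeo] by blast
      ultimately obtain N where N: "openin (compact_open_topology X) N" "h \<in> N"
        "\<And>k x. k \<in> N \<Longrightarrow> x \<in> topspace X \<Longrightarrow> dist ((f \<circ> g) (k x)) ((f \<circ> g) (h x)) < e/2"
        using compact_open_uniformly_close[OF X(1), of "f \<circ> g" h "e/2"] \<open>0 < e\<close> by auto
      have "d (g \<otimes>\<^bsub>Homeo X\<^esub> k) (g \<otimes>\<^bsub>Homeo X\<^esub> h) < e" if k: "k \<in> G" "k \<in> N" for k
      proof -
        have "d (g \<otimes>\<^bsub>Homeo X\<^esub> k) (g \<otimes>\<^bsub>Homeo X\<^esub> h) \<le> e/2"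
          using gh k N(3)[OF k(2)] by (intro least) (auto simp: mult_apply intro: less_imp_le)
        then show ?thesis using \<open>0 < e\<close> by simp
      qed
      moreover have "openin (subtopology (compact_open_topology X) G) (G \<inter> N)"
        using N(1) by (rule openin_subtopology_Int2)
      ultimately show ?thesis using N(2) gh by (intro exI[of _ "G \<inter> N"]) auto
    qed
  qed
qed

text \<open>A path that starts in \<open>D\<close> and leaves \<open>D0\<close> can be stretched, by an element of \<open>G\<close> supported
  in \<open>W i\<close>, so that before leaving \<open>T i\<close> it winds \<open>i\<close> times around the origin. Any two homeomorphisms
  that make a given path wind a different number of times are far apart, so these winding numbers
  are infinitely many uniformly separated colours.\<close>

theorem winding_not_metrizable:
  fixes M :: "'m topology" and p :: "'a \<Rightarrow> complex" and T W :: "nat \<Rightarrow> 'a set"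
  assumes X: "compact_space X" "path_connected_space X"
    and lt: "locally_transitive X G"
    and p: "continuous_map X euclidean p"
    and D: "openin X D" "D \<noteq> {}" "D \<subseteq> D0" "p ` D \<subseteq> cball 0 1"
    and D0: "openin X D0" "D0 \<noteq> topspace X" "\<And>i. X closure_of D0 \<subseteq> T i"
    and T: "\<And>i. p ` T i \<subseteq> spiral (real i)"
    and W: "\<And>i. openin X (W i)" "\<And>i. connectedin X (W i)" "\<And>i. W i \<subseteq> T i" "\<And>i. W i \<inter> D = {}"
      "\<And>i. X closure_of D0 - D0 \<subseteq> W i" "\<And>i. \<exists>x\<in>W i. 3 < cmod (p x)"
    and umf: "universal_minimal_flow (Homeo X\<lparr>carrier := G\<rparr>)
      (subtopology (compact_open_topology X) G) M \<phi>"
  shows "\<not> metrizable_space M"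
proof -
  define d where "d g h = (SUP x\<in>topspace X. dist (p (g x)) (p (h x)))" for g h
  have ne: "topspace X \<noteq> {}" using openin_subset[OF D(1)] D(2) by blast
  interpret P: right_invariant_pseudometric "Homeo X\<lparr>carrier := G\<rparr>"
      "subtopology (compact_open_topology X) G" d
    using sup_pseudometric(1)[OF X(1) ne p] unfolding d_def .
  have d_upper: "dist (p (g x)) (p (h x)) \<le> d g h" if "g \<in> G" "h \<in> G" "x \<in> topspace X" for g h x
    using sup_pseudometric(2)[OF X(1) ne p] that unfolding d_def by blast
  have conn: "connectedin X (topspace X)"
    using X(2) path_connected_imp_connected_space connectedin_topspace by blast
  obtain c where c: "c \<in> D" using D by blast
  then have cX: "c \<in> topspace X" using openin_subset[OF D(1)] by blast
  \<comment> \<open>As \<open>X\<close> is connected, \<open>G\<close> is transitive on it; by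
    compactness finitely many elements suffice to bring any point into \<open>D\<close>.\<close>
  have "\<exists>K. finite K \<and> K \<subseteq> G \<and> (\<forall>x\<in>topspace X. \<exists>k\<in>K. k x \<in> D)"
  proof (rule finite_translates_into_open)
    show "compactin X (topspace X)" using X by (simp add: compact_space_def)
    show "\<exists>g\<in>G. g x \<in> D" if x: "x \<in> topspace X" for x
    proof -
      obtain g where "g \<in> rigid_stabilizer X G (topspace X)" "g x = c"
        by (rule rigid_stabilizer_transitive[OF lt openin_topspace conn x cX])
      then show ?thesis using c by (auto simp: rigid_stabilizer_def)
    qed
  qed (use D in auto)
  then obtain K where K: "finite K" "K \<subseteq> G" "\<And>x. x \<in> topspace X \<Longrightarrow> \<exists>k\<in>K. k x \<in> D"
    by blast
  \<comment> \<open>Each point of the compact frontier of \<open>D0\<close> can be moved within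
    \<open>W i\<close> beyond radius 3, again by finitely many elements.\<close>
  have "\<exists>H. finite H \<and> H \<subseteq> rigid_stabilizer X G (W i) \<and>
      (\<forall>x\<in>X closure_of D0 - D0. \<exists>h\<in>H. 3 < cmod (p (h x)))" for i
  proof -
    have "closedin X (X closure_of D0 - D0)" using D0(1) by (intro closedin_diff) auto
    with X(1) have cpt: "compactin X (X closure_of D0 - D0)" by (rule closedin_compact_space)
    have opn: "openin X {x \<in> topspace X. p x \<in> - cball 0 3}"
      using p by (rule openin_continuous_map_preimage) (auto simp: open_Compl)
    have RG: "rigid_stabilizer X G (W i) \<subseteq> G" by (auto simp: rigid_stabilizer_def)
    have hit: "\<exists>h\<in>rigid_stabilizer X G (W i). h x \<in> {x \<in> topspace X. p x \<in> - cball 0 3}"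
      if "x \<in> X closure_of D0 - D0" for x
    proof -
      have xW: "x \<in> W i" using W(5) that by blast
      obtain y where y: "y \<in> W i" "3 < cmod (p y)" using W(6) by blast
      obtain h where "h \<in> rigid_stabilizer X G (W i)" "h x = y"
        by (rule rigid_stabilizer_transitive[OF lt W(1,2) xW y(1)])
      moreover have "y \<in> topspace X" using y openin_subset[OF W(1)] by blast
      ultimately show ?thesis using y by (intro bexI[of _ h]) auto
    qed
    have "\<exists>H. finite H \<and> H \<subseteq> rigid_stabilizer X G (W i) \<and>
        (\<forall>x\<in>X closure_of D0 - D0. \<exists>h\<in>H. h x \<in> {x \<in> topspace X. p x \<in> - cball 0 3})"
      by (rule finite_translates_into_open[OF cpt opn RG hit])
    then obtain H where "finite H" "H \<subseteq> rigid_stabilizer X G (W i)"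
        and hit: "\<forall>x\<in>X closure_of D0 - D0. \<exists>h\<in>H. h x \<in> {x \<in> topspace X. p x \<in> - cball 0 3}"
      by (elim exE conjE)
    moreover have "\<exists>h\<in>H. 3 < cmod (p (h x))" if "x \<in> X closure_of D0 - D0" for x
      using bspec[OF hit that] by (force simp: not_le)
    ultimately show ?thesis by (intro exI[of _ H] conjI ballI)
  qed
  then obtain H where H: "\<And>i. finite (H i)" "\<And>i. H i \<subseteq> rigid_stabilizer X G (W i)"
    "\<And>i x. x \<in> X closure_of D0 - D0 \<Longrightarrow> \<exists>h\<in>H i. 3 < cmod (p (h x))" by metis
  have HG: "H i \<subseteq> G" for i using H(2) by (auto simp: rigid_stabilizer_def)
  \<comment> \<open>First \<open>k\<close> brings the start of the path into \<open>D\<close>, then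
    \<open>h\<close> pushes its exit point from \<open>D0\<close> far out. Both finite sets are
    fixed before \<open>Q\<close>.\<close>
  define B where "B i = (\<lambda>(h, k). h \<otimes>\<^bsub>Homeo X\<^esub> k) ` (H i \<times> K)" for i
  show ?thesis
  proof (rule P.universal_minimal_flow_not_metrizable[OF umf, of B])
    show "finite (B i)" for i using H K by (auto simp: B_def)
    show "B i \<subseteq> carrier (Homeo X\<lparr>carrier := G\<rparr>)" for i
      using HG K mult_closed by (fastforce simp: B_def)
    fix Q assume "finite Q" "Q \<subseteq> carrier (Homeo X\<lparr>carrier := G\<rparr>)"
    then have Q: "finite Q" "Q \<subseteq> G" by auto
    \<comment> \<open>The path has to leave \<open>D0\<close> after applying any \<open>g\<close> in
      \<open>Q\<close> and any \<open>k\<close> in \<open>K\<close>, so it is led through the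
      preimages of one point \<open>y\<close> outside \<open>D0\<close> under all these
      products.\<close>
    obtain y where y: "y \<in> topspace X" "y \<notin> D0" using D0(2) openin_subset[OF D0(1)] by blast
    have "\<exists>x. x \<in> topspace X \<and> k (g x) = y" if "k \<in> K" "g \<in> Q" for k g
      using that K Q y surj by (metis subsetD)
    then obtain z where z: "\<And>k g. k \<in> K \<Longrightarrow> g \<in> Q \<Longrightarrow> z k g \<in> topspace X \<and> k (g (z k g)) = y"
      by metis
    obtain \<beta> where \<beta>: "pathin X \<beta>" "(\<lambda>(k, g). z k g) ` (K \<times> Q) \<subseteq> \<beta> ` {0..1}"
      by (rule path_through_finite_set[OF X(2) ne, of "(\<lambda>(k, g). z k g) ` (K \<times> Q)"])
        (use K Q z in auto)
    have \<beta>X: "\<beta> s \<in> topspace X" if "s \<in> {0..1}" for s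
      using path_image_subset_topspace[OF \<beta>(1)] that by auto
    \<comment> \<open>The colour is witnessed at a time \<open>t\<close> up to which the image path
      stays in \<open>T i\<close>; its later course is unrestricted.\<close>
    define A where "A i = {a \<in> G. a (\<beta> 0) \<in> D \<and>
      (\<exists>t\<in>{0..1}. (\<forall>s\<in>{0..t}. a (\<beta> s) \<in> T i) \<and> 3 < cmod (p (a (\<beta> t))))}" for i
    have cont: "continuous_on {0..t} (\<lambda>s. p (a (\<beta> s)))" if "a \<in> G" "t \<in> {0..1}" for a t
    proof -
      have "continuous_map (top_of_set {0..1}) euclidean (p \<circ> (a \<circ> \<beta>))"
        using \<beta>(1) continuous[OF that(1)] p unfolding pathin_def by (intro continuous_map_compose)
      then have "continuous_on {0..1} (\<lambda>s. p (a (\<beta> s)))" by (simp add: comp_def)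
      then show ?thesis by (rule continuous_on_subset) (use that in auto)
    qed
    \<comment> \<open>Radius 3 leaves room: at time \<open>t\<close> the path of \<open>b\<close> is
      within \<open>1/4\<close> of that of \<open>a\<close>, hence beyond radius 2, where the
      winding is complete.\<close>
    have winding: "i = j"
      if a: "a \<in> G" "a (\<beta> 0) \<in> D" "\<And>s. s \<in> {0..t} \<Longrightarrow> a (\<beta> s) \<in> T i" "3 < cmod (p (a (\<beta> t)))"
        and b: "b \<in> G" "b (\<beta> 0) \<in> D" "\<And>s. s \<in> {0..t} \<Longrightarrow> b (\<beta> s) \<in> T j"
        and t: "t \<in> {0..1}" and near: "d a b < 1/4" for a b i j t
    proof (rule spiral_paths_same_winding[of t "\<lambda>s. p (a (\<beta> s))" i "\<lambda>s. p (b (\<beta> s))" j])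
      show *: "dist (p (a (\<beta> s))) (p (b (\<beta> s))) < 1/4" if "s \<in> {0..t}" for s
        using d_upper[OF a(1) b(1), of "\<beta> s"] \<beta>X[of s] near t that by auto
      have "cmod (p (a (\<beta> t))) \<le> dist (p (a (\<beta> t))) (p (b (\<beta> t))) + cmod (p (b (\<beta> t)))"
        using dist_triangle[of "p (a (\<beta> t))" 0 "p (b (\<beta> t))"] by simp
      then show "2 \<le> cmod (p (b (\<beta> t)))" using *[of t] a(4) t by auto
      show "cmod (p (a (\<beta> 0))) \<le> 1" "cmod (p (b (\<beta> 0))) \<le> 1" using a(2) b(2) D(4) by auto
      show "(\<lambda>s. p (a (\<beta> s))) \<in> {0..t} \<rightarrow> spiral i" "(\<lambda>s. p (b (\<beta> s))) \<in> {0..t} \<rightarrow> spiral j"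
        using a(3) b(3) by (auto intro!: subsetD[OF T] imageI)
    qed (use t a b in \<open>auto intro!: cont\<close>)
    have sep: "1/4 \<le> d a b" if ij: "i \<noteq> j" and aA: "a \<in> A i" and bA: "b \<in> A j" for i j a b
    proof (rule ccontr)
      assume "\<not> 1/4 \<le> d a b"
      then have near: "d a b < 1/4" by simp
      obtain t where t: "t \<in> {0..1}" "\<And>s. s \<in> {0..t} \<Longrightarrow> a (\<beta> s) \<in> T i" "3 < cmod (p (a (\<beta> t)))"
        using aA by (auto simp: A_def)
      obtain t' where t': "t' \<in> {0..1}" "\<And>s. s \<in> {0..t'} \<Longrightarrow> b (\<beta> s) \<in> T j" "3 < cmod (p (b (\<beta> t')))"
        using bA by (auto simp: A_def)
      have ab: "a \<in> G" "b \<in> G" "a (\<beta> 0) \<in> D" "b (\<beta> 0) \<in> D" using aA bA by (auto simp: A_def)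
      have near': "d b a < 1/4" using near P.d_commute[of a b] ab by simp
      \<comment> \<open>The comparison runs up to the earlier of the two witness times, when both
        paths are still in their sets \<open>T i\<close> and \<open>T j\<close>.\<close>
      show False
      proof (cases "t \<le> t'")
        case True
        have "i = j"
          by (rule winding[of a t i b j]) (use ab t t' near True in auto)
        with ij show False by simp
      next
        case False
        have "j = i"
          by (rule winding[of b t' j a i]) (use ab t t' near' False in auto)
        with ij show False by simp
      qed
    qed
    have hit: "\<exists>b\<in>B i. b \<otimes>\<^bsub>Homeo X\<^esub> g \<in> A i" if g: "g \<in> Q" for g i
    proof -
      have gG: "g \<in> G" using g Q by blast
      have 0: "\<beta> 0 \<in> topspace X" using \<beta>X by simp
      obtain k where k: "k \<in> K" "k (g (\<beta> 0)) \<in> D" using K(3)[OF closed_apply[OF gG 0]] by blast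
      have kG: "k \<in> G" using k K by blast
      define \<alpha> where "\<alpha> = k \<circ> (g \<circ> \<beta>)"
      have "pathin X \<alpha>"
        unfolding \<alpha>_def using \<beta>(1) continuous gG kG by (intro pathin_compose)
      moreover obtain s where "s \<in> {0..1}" "\<beta> s = z k g" using \<beta>(2) k(1) g by force
      then have "s \<in> {0..1}" "\<alpha> s \<notin> D0" using z[OF k(1) g] y by (auto simp: \<alpha>_def)
      moreover have "\<alpha> 0 \<in> D0" using k D by (auto simp: \<alpha>_def)
      ultimately obtain t where t: "t \<in> {0..1}" "\<alpha> t \<in> X closure_of D0 - D0"
          "\<And>s. s \<in> {0..t} \<Longrightarrow> \<alpha> s \<in> X closure_of D0"
        using path_first_exit[of X \<alpha> D0 s] D0(1) by blast
      obtain h where h: "h \<in> H i" "3 < cmod (p (h (\<alpha> t)))" using H(3)[OF t(2)] by blast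
      have hR: "h \<in> rigid_stabilizer X G (W i)" and hG: "h \<in> G" using h H(2) HG by auto
      have WX: "W i \<subseteq> topspace X" using W(1) by (rule openin_subset)
      have \<alpha>X: "\<alpha> s \<in> topspace X" if "s \<in> {0..1}" for s
        using closed_apply[OF kG closed_apply[OF gG \<beta>X[OF that]]] by (simp add: \<alpha>_def)
      let ?a = "h \<otimes>\<^bsub>Homeo X\<^esub> k \<otimes>\<^bsub>Homeo X\<^esub> g"
      have a: "?a (\<beta> s) = h (\<alpha> s)" if "s \<in> {0..1}" for s
        using \<beta>X[OF that] closed_apply[OF gG] hG kG gG mult_closed by (simp add: mult_apply \<alpha>_def)
      have fix_out: "h x = x" if "x \<in> topspace X" "x \<notin> W i" for x
        using hR that by (auto simp: rigid_stabilizer_def)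
      \<comment> \<open>The support \<open>W i\<close> of \<open>h\<close> avoids \<open>D\<close>,
        so the start stays in place. It lies in \<open>T i\<close>, so \<open>h\<close> also maps
        \<open>T i\<close> into itself.\<close>
      have "h (\<alpha> 0) = \<alpha> 0"
        using k W(4)[of i] \<alpha>X[of 0] by (intro fix_out) (auto simp: \<alpha>_def)
      then have "?a (\<beta> 0) \<in> D" using k a[of 0] by (simp add: \<alpha>_def)
      moreover have "?a (\<beta> s) \<in> T i" if s: "s \<in> {0..t}" for s
      proof -
        have s1: "s \<in> {0..1}" using s t by auto
        have "\<alpha> s \<in> T i" using t(3)[OF s] D0(3) by blast
        then have "h (\<alpha> s) \<in> T i"
          using rigid_stabilizer_mem[OF hR WX] W(3) fix_out[OF \<alpha>X[OF s1]]
          by (cases "\<alpha> s \<in> W i") auto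
        then show ?thesis using a[OF s1] by simp
      qed
      moreover have "3 < cmod (p (?a (\<beta> t)))" using h a[OF t(1)] by simp
      moreover have "?a \<in> G" using hG kG gG mult_closed by blast
      ultimately have "?a \<in> A i" using t(1) unfolding A_def by blast
      then show ?thesis using h(1) k(1) by (force simp: B_def)
    qed
    show "\<exists>A :: nat \<Rightarrow> ('a \<Rightarrow> 'a) set. (\<forall>i. A i \<subseteq> carrier (Homeo X\<lparr>carrier := G\<rparr>)) \<and>
      (\<forall>i j. i \<noteq> j \<longrightarrow> (\<forall>a\<in>A i. \<forall>b\<in>A j. 1/4 \<le> d a b)) \<and>
      (\<forall>g\<in>Q. \<forall>i. \<exists>h\<in>B i. h \<otimes>\<^bsub>Homeo X\<lparr>carrier := G\<rparr>\<^esub> g \<in> A i)"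
      using sep hit by (intro exI[of _ A]) (auto simp: A_def)
  qed
qed

end


section \<open>Charts\<close>

text \<open>The straight model of a spiral: twisting it by \<open>k\<close> gives a subset of
  \<open>spiral k\<close>. It contains a disc about \<open>3/4\<close> within the unit disc, where
  paths start, and the point \<open>7/2\<close> beyond radius 3, where they may end.\<close>

definition strip :: "complex set" where
  "strip = box (Complex (1/2) (-1/4)) (Complex 4 (1/4))"

lemma strip_iff: "z \<in> strip \<longleftrightarrow> 1/2 < Re z \<and> Re z < 4 \<and> \<bar>Im z\<bar> < 1/4"
  by (auto simp: strip_def in_box_complex_iff)

lemma Re_Im_near_centre:
  assumes "z \<in> cball (3/4) r"
  shows "\<bar>Re z - 3/4\<bar> \<le> r" "\<bar>Im z\<bar> \<le> r"
  using assms abs_Re_le_cmod[of "z - 3/4"] abs_Im_le_cmod[of "z - 3/4"]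
  by (auto simp: dist_norm norm_minus_commute)

lemma cball_subset_strip: "cball (3/4) (1/8) \<subseteq> strip"
proof
  fix z :: complex assume "z \<in> cball (3/4) (1/8)"
  from Re_Im_near_centre[OF this] show "z \<in> strip" unfolding strip_iff by (intro conjI) linarith+
qed

text \<open>The set is the union of the complements of slightly larger open discs; these are
  connected and share the point 2.\<close>

lemma connected_strip_minus_cball: "connected (strip - cball (3/4) (1/16))"
proof -
  let ?F = "(\<lambda>r. strip - ball (3/4) r) ` {1/16<..1/8}"
  have "connected (strip - ball (3/4) r)" if "r \<in> {1/16<..1/8}" for r
  proof (rule connected_diff_ball)
    show "connected strip" by (simp add: strip_def convex_connected)
    show "cball (3/4) r \<subseteq> strip"
      using that cball_subset_strip subset_cball[of r "1/8" "3/4::complex"] by auto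
  qed simp
  moreover have "2 \<in> \<Inter>?F" by (auto simp: strip_iff dist_norm)
  ultimately have "connected (\<Union>?F)" by (intro connected_Union) auto
  moreover have "\<Union>?F = strip - cball (3/4) (1/16)"
  proof
    show "strip - cball (3/4) (1/16) \<subseteq> \<Union>?F"
    proof
      fix z assume z: "z \<in> strip - cball (3/4) (1/16)"
      then have "min (1/8) (dist (3/4) z) \<in> {1/16<..1/8}" "z \<notin> ball (3/4) (min (1/8) (dist (3/4) z))"
        by auto
      with z show "z \<in> \<Union>?F" by blast
    qed
  qed auto
  ultimately show ?thesis by simp
qed

lemma open_twist_preimage: "open S \<Longrightarrow> open (twist k -` S)"
  using open_vimage continuous_on_twist by blast

text \<open>The preimage form gives openness and the image form connectedness, both from continuity
  of the twists.\<close>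

lemma twist_vimage_eq_image: "twist (- k) -` S = twist k ` S"
proof
  show "twist (- k) -` S \<subseteq> twist k ` S"
  proof
    fix z assume "z \<in> twist (- k) -` S"
    then show "z \<in> twist k ` S" by (intro image_eqI[of _ _ "twist (- k) z"]) auto
  qed
qed auto

text \<open>The disc lies in the unit disc, where twists are the identity. So the starting region is
  the same for all winding numbers.\<close>

lemma twist_vimage_cball:
  assumes "r \<le> 1/8" shows "twist (- k) -` cball (3/4) r = cball (3/4) r"
proof -
  have *: "cmod z \<le> 1" if "z \<in> cball (3/4) r" for z
  proof -
    have "cmod z \<le> cmod (z - 3/4) + cmod (3/4)" using norm_triangle_ineq[of "z - 3/4" "3/4"] by simp
    then show ?thesis using that assms by (simp add: dist_norm norm_minus_commute)
  qed
  have "z \<in> cball (3/4) r" if "twist (- k) z \<in> cball (3/4) r" for z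
    using *[OF that] that by (simp add: twist_eq_self)
  moreover have "twist (- k) z \<in> cball (3/4) r" if "z \<in> cball (3/4) r" for z
    using *[OF that] that by (simp add: twist_eq_self)
  ultimately show ?thesis by auto
qed

lemma continuous_map_Complex:
  assumes "continuous_map X euclideanreal f" "continuous_map X euclideanreal g"
  shows "continuous_map X euclidean (\<lambda>x. Complex (f x) (g x))"
proof -
  have "continuous_map X (prod_topology euclideanreal euclideanreal) (\<lambda>x. (f x, g x))"
    using assms by (intro continuous_map_pairedI)
  moreover have "continuous_map (prod_topology euclideanreal euclideanreal) euclidean (\<lambda>(a, b). Complex a b)"
    by (simp add: case_prod_unfold) (intro continuous_intros)
  ultimately have "continuous_map X euclidean ((\<lambda>(a, b). Complex a b) \<circ> (\<lambda>x. (f x, g x)))"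
    by (rule continuous_map_compose)
  then show ?thesis by (simp add: comp_def)
qed

text \<open>Real and imaginary parts are extended separately.\<close>

lemma complex_Tietze_extension:
  fixes f :: "'a \<Rightarrow> complex"
  assumes "normal_space X" "closedin X S" "continuous_map (subtopology X S) euclidean f"
  obtains g where "continuous_map X euclidean g" "\<And>x. x \<in> S \<Longrightarrow> g x = f x"
proof -
  have ext: "\<exists>g. continuous_map X euclideanreal g \<and> (\<forall>x\<in>S. g x = h x)"
    if h: "continuous_map (subtopology X S) euclideanreal h" for h
    by (rule Tietze_extension_realinterval[OF assms(1,2) is_interval_univ _ h]) auto
  have parts: "continuous_map (subtopology X S) euclideanreal (Re \<circ> f)"
    "continuous_map (subtopology X S) euclideanreal (Im \<circ> f)"
    using assms(3) by (auto intro!: continuous_map_compose simp: continuous_on_Re continuous_on_Im continuous_on_id)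
  obtain g1 g2 where g: "continuous_map X euclideanreal g1" "\<forall>x\<in>S. g1 x = (Re \<circ> f) x"
    "continuous_map X euclideanreal g2" "\<forall>x\<in>S. g2 x = (Im \<circ> f) x"
    using ext[OF parts(1)] ext[OF parts(2)] by (elim exE conjE)
  have "continuous_map X euclidean (\<lambda>x. Complex (g1 x) (g2 x))"
    using g(1,3) by (rule continuous_map_Complex)
  then show thesis by (rule that) (simp add: g complex_eq_iff)
qed

section \<open>Charts with a planar factor\<close>

context homeomorphism_group
begin

text \<open>The plane carries the winding, \<open>F\<close> only nested neighbourhoods.
  \<open>D\<close> is a disc times \<open>F1\<close>, \<open>D0\<close> a larger disc times
  \<open>F2\<close>, and \<open>T i\<close> a twisted strip times \<open>F3\<close>. Removing a
  closed disc times \<open>C1\<close> from \<open>T i\<close> leaves \<open>W i\<close> disjoint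
  from \<open>D\<close> but still containing the frontier of \<open>D0\<close>. Compactness of the
  sets \<open>Cj\<close> makes the relevant images closed in \<open>X\<close>.\<close>

theorem product_chart_not_metrizable:
  fixes M :: "'m topology" and F :: "'f topology" and \<iota> :: "complex \<times> 'f \<Rightarrow> 'a"
  assumes X: "compact_space X" "Hausdorff_space X" "path_connected_space X"
    and lt: "locally_transitive X G"
    and U: "openin X U"
    and \<iota>: "homeomorphic_map (prod_topology euclidean F) (subtopology X U) \<iota>"
    and HF: "Hausdorff_space F"
    and F: "openin F F1" "F1 \<noteq> {}" "F1 \<subseteq> C1" "compactin F C1" "C1 \<subseteq> F2"
      "openin F F2" "F2 \<subseteq> C2" "compactin F C2" "C2 \<subseteq> F3"
      "openin F F3" "connectedin F F3" "F3 \<subseteq> C3" "compactin F C3"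
    and umf: "universal_minimal_flow (Homeo X\<lparr>carrier := G\<rparr>)
      (subtopology (compact_open_topology X) G) M \<phi>"
  shows "\<not> metrizable_space M"
proof -
  let ?P = "prod_topology (euclidean :: complex topology) F"
  have UX: "U \<subseteq> topspace X" using U by (rule openin_subset)
  have \<iota>c: "continuous_map ?P X \<iota>"
    using homeomorphic_imp_continuous_map[OF \<iota>] by (simp add: continuous_map_in_subtopology)
  have \<iota>_open: "openin X (\<iota> ` S)" if "openin ?P S" for S
    using homeomorphic_imp_open_map[OF \<iota>] that U openin_trans_full unfolding open_map_def by blast
  have \<iota>_closed: "closedin X (\<iota> ` S)" if "compactin ?P S" for S
    using image_compactin[OF that \<iota>c] X(2) by (simp add: compactin_imp_closedin)
  have \<iota>_conn: "connectedin X (\<iota> ` S)" if "connectedin ?P S" for S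
    using \<iota>c that by (rule connectedin_continuous_map_image)
  have \<iota>_inj: "inj_on \<iota> (UNIV \<times> topspace F)"
    using homeomorphic_imp_injective_map[OF \<iota>] by simp
  have F3F: "F3 \<subseteq> topspace F" using openin_subset[OF F(10)] .
  obtain \<kappa> where \<kappa>: "homeomorphic_maps ?P (subtopology X U) \<iota> \<kappa>"
    using \<iota> homeomorphic_map_maps by blast
  \<comment> \<open>Radius 5 bounds all moduli in the twisted strips, so an extension of the planar
    coordinate from \<open>K\<close> is known on every \<open>T i\<close>.\<close>
  define K where "K = \<iota> ` (cball 0 5 \<times> C3)"
  have K: "closedin X K"
    unfolding K_def using F(13) by (intro \<iota>_closed) (simp add: compactin_Times)
  have C3F: "C3 \<subseteq> topspace F" using compactin_subset_topspace[OF F(13)] .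
  have \<kappa>\<iota>: "\<kappa> (\<iota> x) = x" if "x \<in> UNIV \<times> topspace F" for x
    using \<kappa> that by (auto simp: homeomorphic_maps_def)
  have "\<iota> ` topspace ?P \<subseteq> U"
    using homeomorphic_imp_surjective_map[OF \<iota>] by auto
  then have KU: "K \<subseteq> U" using C3F by (auto simp: K_def)
  have "continuous_map (subtopology X U) euclidean (fst \<circ> \<kappa>)"
    using \<kappa> by (intro continuous_map_compose[OF _ continuous_map_fst]) (auto simp: homeomorphic_maps_def)
  then have "continuous_map (subtopology X K) euclidean (fst \<circ> \<kappa>)"
    using KU by (rule continuous_map_from_subtopology_mono)
  moreover have "normal_space X" using X by (simp add: compact_Hausdorff_or_regular_imp_normal_space)
  ultimately obtain p where p: "continuous_map X euclidean p" "\<And>x. x \<in> K \<Longrightarrow> p x = (fst \<circ> \<kappa>) x"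
    using complex_Tietze_extension[of X K "fst \<circ> \<kappa>"] K by metis
  have p\<iota>: "p (\<iota> (z, f)) = z" if "cmod z \<le> 5" "f \<in> C3" for z f
  proof -
    have "\<iota> (z, f) \<in> K" using that by (auto simp: K_def)
    then show ?thesis using p(2) \<kappa>\<iota>[of "(z, f)"] that C3F by auto
  qed
  define S where "S i = twist (- real i) -` strip" for i :: nat
  define D where "D = \<iota> ` (ball (3/4) (1/16) \<times> F1)"
  define D0 where "D0 = \<iota> ` (ball (3/4) (1/8) \<times> F2)"
  define T where "T i = \<iota> ` (S i \<times> F3)" for i
  define W where "W i = \<iota> ` (S i \<times> F3 - cball (3/4) (1/16) \<times> C1)" for i
  have open_S: "open (S i)" for i
    unfolding S_def by (intro open_twist_preimage) (simp add: strip_def open_box)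
  have S_norm: "1/2 < cmod z \<and> cmod z \<le> 5" if "z \<in> S i" for z i
  proof -
    let ?w = "twist (- real i) z"
    have w: "1/2 < Re ?w" "Re ?w < 4" "\<bar>Im ?w\<bar> < 1/4" using that by (auto simp: S_def strip_iff)
    then have "1/2 < cmod ?w" using complex_Re_le_cmod[of ?w] by linarith
    moreover have "cmod ?w \<le> 5" using cmod_le[of ?w] w by linarith
    ultimately show ?thesis by simp
  qed
  have ball_S: "cball (3/4) (1/8) \<subseteq> S i" for i
    using vimage_mono[OF cball_subset_strip, of "twist (- real i)"] by (simp add: S_def twist_vimage_cball)
  have ball_norm: "cmod z \<le> 1" if "z \<in> cball (3/4) (1/8)" for z
    using norm_triangle_ineq[of "z - 3/4" "3/4"] that by (simp add: dist_norm norm_minus_commute)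
  have small_ball: "cball (3/4) (1/16) \<subseteq> ball (3/4 :: complex) (1/8)" by auto
  obtain f where f: "f \<in> F1" using F(2) by blast
  have sub: "F1 \<subseteq> F3" "F1 \<subseteq> C3" "F2 \<subseteq> C3" using F(3,5,7,9,12) by blast+
  then have fC: "f \<in> F3" "f \<in> C3" using f by blast+
  have end_in: "twist (real i) (7/2) \<in> S i - cball (3/4) (1/16)" for i
    using ball_norm[of "twist (real i) (7/2)"] by (auto simp: S_def strip_iff)
  have far: "\<exists>x\<in>W i. 3 < cmod (p x)" for i
  proof -
    let ?z = "twist (real i) (7/2)"
    have "\<iota> (?z, f) \<in> W i" unfolding W_def using fC end_in[of i] by (intro imageI) blast
    moreover have "p (\<iota> (?z, f)) = ?z" using fC by (intro p\<iota>) auto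
    ultimately show ?thesis by (intro bexI[of _ "\<iota> (?z, f)"]) auto
  qed
  have pD0: "p ` D0 \<subseteq> cball 0 1"
  proof -
    have "cmod (p (\<iota> (z, g))) \<le> 1" if "z \<in> ball (3/4) (1/8)" "g \<in> F2" for z g
    proof -
      have "cmod z \<le> 1" using ball_norm[of z] that by auto
      moreover have "g \<in> C3" using that sub by blast
      ultimately show ?thesis using p\<iota>[of z g] by simp
    qed
    then show ?thesis by (auto simp: D0_def)
  qed
  have W_open: "openin X (W i)" for i
    unfolding W_def
  proof (rule \<iota>_open)
    have "closedin F C1" using HF F(4) by (rule compactin_imp_closedin)
    then show "openin ?P (S i \<times> F3 - cball (3/4) (1/16) \<times> C1)"
      using open_S F(10) by (intro openin_diff) (auto simp: openin_prod_Times_iff closedin_prod_Times_iff)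
  qed
  \<comment> \<open>\<open>W i\<close> consists of the strip without the disc, times
    \<open>F3\<close>, together with full slices over the points of \<open>F3 - C1\<close>. Each
    slice meets the former, connected piece; if \<open>F3 = C1\<close>, there are no slices.\<close>
  have W_conn: "connectedin X (W i)" for i
    unfolding W_def
  proof (rule \<iota>_conn)
    let ?A = "S i - cball (3/4) (1/16)"
    have "?A = twist (- real i) -` (strip - cball (3/4) (1/16))"
      by (simp add: S_def vimage_Diff twist_vimage_cball)
    also have "connected \<dots>"
      unfolding twist_vimage_eq_image
      by (rule connected_continuous_image[OF continuous_on_twist connected_strip_minus_cball])
    finally have A: "connectedin ?P (?A \<times> F3)" using F by (simp add: connectedin_Times)
    have "connected (S i)"
      unfolding S_def twist_vimage_eq_image
      by (intro connected_continuous_image[OF continuous_on_twist]) (simp add: strip_def convex_connected)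
    then have slice: "connectedin ?P (S i \<times> {g})" if "g \<in> F3" for g
      using that F3F by (auto simp: connectedin_Times)
    obtain z where z: "z \<in> ?A" using end_in by blast
    have "connectedin ?P (\<Union>g\<in>F3 - C1. ?A \<times> F3 \<union> S i \<times> {g})" if "F3 - C1 \<noteq> {}"
    proof (rule connectedin_Union)
      show "connectedin ?P Z" if Z: "Z \<in> (\<lambda>g. ?A \<times> F3 \<union> S i \<times> {g}) ` (F3 - C1)" for Z
      proof -
        obtain g where g: "g \<in> F3" "Z = ?A \<times> F3 \<union> S i \<times> {g}" using Z by blast
        then have "(?A \<times> F3) \<inter> (S i \<times> {g}) \<noteq> {}" using z by blast
        then show ?thesis unfolding g(2) using A slice[OF g(1)] by (intro connectedin_Un) auto
      qed
      have "(z, f) \<in> \<Inter>((\<lambda>g. ?A \<times> F3 \<union> S i \<times> {g}) ` (F3 - C1))" using z fC by blast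
      then show "\<Inter>((\<lambda>g. ?A \<times> F3 \<union> S i \<times> {g}) ` (F3 - C1)) \<noteq> {}" by blast
    qed
    moreover have "S i \<times> F3 - cball (3/4) (1/16) \<times> C1 =
        (if F3 - C1 = {} then ?A \<times> F3 else (\<Union>g\<in>F3 - C1. ?A \<times> F3 \<union> S i \<times> {g}))"
      by auto
    ultimately show "connectedin ?P (S i \<times> F3 - cball (3/4) (1/16) \<times> C1)"
      using A by presburger
  qed
  have cl_D0: "X closure_of D0 \<subseteq> \<iota> ` (cball (3/4) (1/8) \<times> C2)"
  proof (rule closure_of_minimal)
    show "D0 \<subseteq> \<iota> ` (cball (3/4) (1/8) \<times> C2)"
      unfolding D0_def using F(7) by (intro image_mono Sigma_mono ball_subset_cball)
    show "closedin X (\<iota> ` (cball (3/4) (1/8) \<times> C2))"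
      using F(8) by (intro \<iota>_closed) (simp add: compactin_Times)
  qed
  have cl_T: "\<iota> ` (cball (3/4) (1/8) \<times> C2) \<subseteq> T i" for i
    unfolding T_def using ball_S[of i] F(9) by (intro image_mono) blast
  show ?thesis
  proof (rule winding_not_metrizable[OF X(1,3) lt p(1), of D D0 T W])
    show "openin X D" "openin X D0"
      unfolding D_def D0_def using F by (auto intro!: \<iota>_open simp: openin_prod_Times_iff)
    show "D \<noteq> {}" using F by (simp add: D_def)
    show DD0: "D \<subseteq> D0"
      unfolding D_def D0_def using F(3,5) by (intro image_mono Sigma_mono) auto
    show "p ` D \<subseteq> cball 0 1" using pD0 DD0 by blast
    show "D0 \<noteq> topspace X"
    proof
      assume "D0 = topspace X"
      moreover obtain x where x: "x \<in> W 0" "3 < cmod (p x)" using far by blast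
      moreover have "W 0 \<subseteq> topspace X" using W_open by (rule openin_subset)
      ultimately have "p x \<in> cball 0 1" using pD0 by blast
      with x(2) show False by simp
    qed
    show "X closure_of D0 \<subseteq> T i" for i using cl_D0 cl_T by blast
    show "p ` T i \<subseteq> spiral (real i)" for i
    proof -
      have "S i \<subseteq> spiral (real i)"
        using S_norm by (auto simp: spiral_def) (auto simp: S_def strip_iff)
      moreover have "p (\<iota> (z, g)) = z" if "z \<in> S i" "g \<in> F3" for z g
        using S_norm[OF that(1)] subsetD[OF F(12) that(2)] by (intro p\<iota>) auto
      ultimately show ?thesis by (auto simp: T_def)
    qed
    show "openin X (W i)" "connectedin X (W i)" for i by (fact W_open W_conn)+
    show "W i \<subseteq> T i" for i unfolding W_def T_def by (intro image_mono) blast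
    \<comment> \<open>Injectivity of the chart allows the difference to be taken after passing to
      images.\<close>
    have WT: "W i = T i - \<iota> ` (cball (3/4) (1/16) \<times> C1)" for i
      unfolding W_def T_def
      using inj_on_image_set_diff[OF \<iota>_inj, of "S i \<times> F3" "cball (3/4) (1/16) \<times> C1"] F3F
        compactin_subset_topspace[OF F(4)] by blast
    have "D \<subseteq> \<iota> ` (cball (3/4) (1/16) \<times> C1)"
      unfolding D_def using F(3) by (intro image_mono Sigma_mono) auto
    then show "W i \<inter> D = {}" for i unfolding WT by blast
    have "\<iota> ` (cball (3/4) (1/16) \<times> C1) \<subseteq> D0"
      unfolding D0_def using F(5) small_ball by (intro image_mono Sigma_mono) auto
    then show "X closure_of D0 - D0 \<subseteq> W i" for i unfolding WT using cl_D0 cl_T by blast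
    show "\<exists>x\<in>W i. 3 < cmod (p x)" for i by (rule far)
  qed (fact umf)
qed

end

text \<open>The coordinates 0 and 1 are stretched from \<open>S\<close> to the line and joined into
  one complex number, which splits a plane off the product.\<close>

lemma homeomorphic_maps_split_product:
  fixes I :: "nat set" and J :: "real set"
  assumes s: "homeomorphic_maps euclideanreal (top_of_set S) s s'" and I: "0 \<in> I" "1 \<in> I"
  shows "homeomorphic_maps
    (prod_topology euclidean (product_topology (\<lambda>_. top_of_set J) (I - {0, 1})))
    (product_topology (\<lambda>i. top_of_set (if i \<in> {0, 1} then S else J)) I)
    (\<lambda>(z, f). \<lambda>i\<in>I. if i = 0 then s (Re z) else if i = 1 then s (Im z) else f i)
    (\<lambda>x. (Complex (s' (x 0)) (s' (x 1)), restrict x (I - {0, 1})))"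
    (is "homeomorphic_maps ?P ?Q ?f ?g")
proof -
  have sc: "continuous_map euclideanreal (top_of_set S) s"
    and s'c: "continuous_map (top_of_set S) euclideanreal s'"
    and s's: "\<And>x. s' (s x) = x" and ss': "\<And>y. y \<in> S \<Longrightarrow> s (s' y) = y"
    using s by (auto simp: homeomorphic_maps_def)
  have coord: "continuous_map ?P (top_of_set (if i \<in> {0, 1} then S else J)) (\<lambda>p. ?f p i)"
    if "i \<in> I" for i
  proof -
    have Re: "continuous_map ?P euclideanreal (Re \<circ> fst)" and Im: "continuous_map ?P euclideanreal (Im \<circ> fst)"
      by (auto intro!: continuous_map_compose[OF continuous_map_fst] simp: continuous_on_Re continuous_on_Im continuous_on_id)
    consider "i = 0" | "i = 1" | "i \<in> I - {0, 1}" using \<open>i \<in> I\<close> by blast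
    then show ?thesis
    proof cases
      case 1
      then have "(\<lambda>p. ?f p i) = s \<circ> (Re \<circ> fst)" using I by auto
      then show ?thesis using 1 continuous_map_compose[OF Re sc] by simp
    next
      case 2
      then have "(\<lambda>p. ?f p i) = s \<circ> (Im \<circ> fst)" using I by auto
      then show ?thesis using 2 continuous_map_compose[OF Im sc] by simp
    next
      case 3
      then have "(\<lambda>p. ?f p i) = (\<lambda>f. f i) \<circ> snd" using I by auto
      moreover have "continuous_map ?P (top_of_set J) ((\<lambda>f. f i) \<circ> snd)"
        by (rule continuous_map_compose[OF continuous_map_snd continuous_map_product_projection[OF 3]])
      ultimately show ?thesis using 3 by simp
    qed
  qed
  have "continuous_map ?P ?Q ?f"
    unfolding continuous_map_componentwise using coord by auto
  moreover have "continuous_map ?Q ?P ?g"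
  proof (rule continuous_map_pairedI)
    have proj: "continuous_map ?Q (top_of_set (if i \<in> {0, 1} then S else J)) (\<lambda>x. x i)" if "i \<in> I" for i
      using that by (rule continuous_map_product_projection)
    have comp: "continuous_map ?Q euclideanreal (\<lambda>x. s' (x i))" if i: "i \<in> {0, 1}" for i
    proof -
      have "i \<in> I" using i I by blast
      from proj[OF this] have "continuous_map ?Q (top_of_set S) (\<lambda>x. x i)"
        unfolding if_P[OF i] .
      from continuous_map_compose[OF this s'c] show ?thesis by (simp only: comp_def)
    qed
    show "continuous_map ?Q euclidean (\<lambda>x. Complex (s' (x 0)) (s' (x 1)))"
      by (intro continuous_map_Complex comp) auto
    have rest: "continuous_map ?Q (top_of_set J) (\<lambda>x. restrict x (I - {0, 1}) i)" if i: "i \<in> I - {0, 1}" for i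
      using proj[of i] i by auto
    show "continuous_map ?Q (product_topology (\<lambda>_. top_of_set J) (I - {0, 1}))
        (\<lambda>x. restrict x (I - {0, 1}))"
      unfolding continuous_map_componentwise using rest by blast
  qed
  moreover have "?g (?f p) = p" if p: "p \<in> topspace ?P" for p
  proof -
    obtain z f where zf: "p = (z, f)" "f \<in> extensional (I - {0, 1})"
      using p by (cases p) (auto simp: PiE_def)
    then have "restrict (?f (z, f)) (I - {0, 1}) = f"
      by (auto simp: fun_eq_iff extensional_def)
    then show ?thesis using I s's unfolding zf by simp
  qed
  moreover have "?f (?g x) = x" if x: "x \<in> topspace ?Q" for x
  proof -
    have "x 0 \<in> S" "x 1 \<in> S" "x \<in> extensional I" using x I by (auto simp: PiE_iff)
    then show ?thesis using ss' by (auto simp: fun_eq_iff extensional_def)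
  qed
  ultimately show ?thesis unfolding homeomorphic_maps_def by blast
qed

section \<open>Coordinate boxes in manifolds and in the Hilbert cube\<close>

context homeomorphism_group
begin

text \<open>Both kinds of spaces are treated together: \<open>S\<close> is the range of the two
  coordinates split off as a plane, \<open>J\<close> that of the others. With \<open>J\<close> the
  line, concentric cubes serve as nested neighbourhoods; with \<open>J\<close> the unit interval,
  the whole remaining product is compact and connected and serves as all of them.\<close>

lemma box_chart_not_metrizable:
  fixes M :: "'m topology" and I :: "nat set" and J :: "real set"
  assumes X: "compact_space X" "Hausdorff_space X" "path_connected_space X"
    and lt: "locally_transitive X G"
    and U: "openin X U"
    and chart: "product_topology (\<lambda>i. top_of_set (if i \<in> {0, 1} then S else J)) I
      homeomorphic_space subtopology X U"
    and s: "homeomorphic_maps euclideanreal (top_of_set S) s s'" and I: "0 \<in> I" "1 \<in> I"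
    and J: "finite I \<and> J = UNIV \<or> J = {0..1}"
    and umf: "universal_minimal_flow (Homeo X\<lparr>carrier := G\<rparr>)
      (subtopology (compact_open_topology X) G) M \<phi>"
  shows "\<not> metrizable_space M"
proof -
  let ?I = "I - {0, 1}"
  let ?F = "product_topology (\<lambda>_. top_of_set J) ?I"
  let ?P = "prod_topology (euclidean :: complex topology) ?F"
  have "?P homeomorphic_space product_topology (\<lambda>i. top_of_set (if i \<in> {0, 1} then S else J)) I"
    using homeomorphic_maps_split_product[OF s I] unfolding homeomorphic_space_def by blast
  then have "?P homeomorphic_space subtopology X U"
    using chart by (rule homeomorphic_space_trans)
  then obtain \<iota> where \<iota>: "homeomorphic_map ?P (subtopology X U) \<iota>"
    unfolding homeomorphic_space by blast
  have HF: "Hausdorff_space ?F"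
    by (simp add: Hausdorff_space_product_topology Hausdorff_space_subtopology)
  note chart_thm = product_chart_not_metrizable[OF X lt U \<iota> HF _ _ _ _ _ _ _ _ _ _ _ _ _ umf]
  from J show ?thesis
  proof
    assume J: "finite I \<and> J = UNIV"
    \<comment> \<open>Radii 1, 2 and 3 give the nested chain. For \<open>I = {0, 1}\<close>, the
      surface case, all cubes are the same one-point set.\<close>
    define B where "B r = PiE ?I (\<lambda>_. {- r<..<r::real})" for r
    define C where "C r = PiE ?I (\<lambda>_. {- r..r::real})" for r
    have B: "openin ?F (B r)" "connectedin ?F (B r)" for r
      using J by (simp_all add: B_def openin_PiE connectedin_PiE)
    have C: "compactin ?F (C r)" for r
      using J by (simp add: C_def compactin_PiE)
    have BC: "B r \<subseteq> C r" for r unfolding B_def C_def by (intro PiE_mono) auto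
    have CB: "C r \<subseteq> B r'" if "r < r'" for r r' unfolding B_def C_def using that by (intro PiE_mono) auto
    have "B 1 \<noteq> {}" by (auto simp: B_def PiE_eq_empty_iff)
    then show ?thesis
      by (rule chart_thm[OF B(1)[of 1] _ BC C CB[of 1 2] B(1) BC C CB[of 2 3] B(1) B(2) BC C]) simp_all
  next
    assume J: "J = {0..1}"
    have cpt: "compactin ?F (topspace ?F)"
      using J unfolding compact_space_def[symmetric]
      by (simp add: compact_space_product_topology compact_space_subtopology)
    have conn: "connectedin ?F (topspace ?F)"
      using J unfolding connectedin_topspace
      by (simp add: connected_space_product_topology connected_space_subtopology connectedin_absolute)
    have ne: "topspace ?F \<noteq> {}" using J by (auto simp: PiE_eq_empty_iff)
    show ?thesis
      by (rule chart_thm[OF openin_topspace ne order_refl cpt order_refl openin_topspace order_refl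
            cpt order_refl openin_topspace conn order_refl cpt])
  qed
qed

end

text \<open>Local path-connectedness is inherited from the Euclidean charts; together with
  connectedness it gives the claim.\<close>

lemma closed_manifold_path_connected:
  assumes "closed_manifold n X" shows "path_connected_space X"
proof -
  have "locally_path_connected_space X"
    unfolding locally_path_connected_space
  proof (intro allI impI, elim conjE)
    fix V x assume V: "openin X V" "x \<in> V"
    then have "x \<in> topspace X" using openin_subset by blast
    then obtain U where U: "openin X U" "x \<in> U" "subtopology X U homeomorphic_space Euclidean_space n"
      using assms by (auto simp: closed_manifold_def)
    have "locally_path_connected_space (subtopology X U)"
      using U(3) homeomorphic_locally_path_connected_space locally_path_connected_Euclidean_space by blast
    moreover have "openin (subtopology X U) (U \<inter> V)" using V by (simp add: openin_subtopology_Int2)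
    ultimately obtain N where N: "openin (subtopology X U) N" "path_connectedin (subtopology X U) N"
        "x \<in> N" "N \<subseteq> U \<inter> V"
      using V U unfolding locally_path_connected_space by (metis IntI)
    have "openin X N" using N(1) U(1) by (rule openin_trans_full)
    moreover have "path_connectedin X N" using N(2) by (simp add: path_connectedin_subtopology)
    ultimately show "\<exists>N. openin X N \<and> path_connectedin X N \<and> x \<in> N \<and> N \<subseteq> V"
      using N(3,4) by blast
  qed
  then show ?thesis
    using assms by (simp add: path_connected_eq_connected_space closed_manifold_def)
qed

theorem theorem1p1:
  fixes X :: "'a topology" and G :: "('a \<Rightarrow> 'a) set"
    and M :: "'m topology" and \<phi> :: "('a \<Rightarrow> 'a) \<Rightarrow> 'm \<Rightarrow> 'm"
  assumes "(\<exists>n\<ge>2. closed_manifold n X) \<or> X homeomorphic_space Hilbert_cube"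
    and "subgroup G (Homeo X)"
    and "locally_transitive X G"
    and "universal_minimal_flow (Homeo X \<lparr>carrier := G\<rparr>)
           (subtopology (compact_open_topology X) G) M \<phi>"
  shows "\<not> metrizable_space M"
proof -
  interpret homeomorphism_group X G using assms(2) by (rule homeomorphism_group.intro)
  from assms(1) show ?thesis
  proof
    assume "\<exists>n\<ge>2. closed_manifold n X"
    then obtain n where n: "2 \<le> n" and man: "closed_manifold n X" by blast
    then obtain x U where U: "openin X U" "subtopology X U homeomorphic_space Euclidean_space n"
      unfolding closed_manifold_def by blast
    then have "product_topology (\<lambda>i. euclideanreal) {..<n} homeomorphic_space subtopology X U"
      using homeomorphic_Euclidean_space_product_topology homeomorphic_space_sym homeomorphic_space_trans
      by blast
    \<comment> \<open>All coordinates already range over the whole line, so the identity serves as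
      stretching map; \<open>2 \<le> n\<close> puts 0 and 1 into the index set.\<close>
    then have chart: "product_topology (\<lambda>i. top_of_set (if i \<in> {0, 1} then UNIV else UNIV :: real set)) {..<n}
        homeomorphic_space subtopology X U" by simp
    have "homeomorphic_maps euclideanreal (top_of_set UNIV) id id" by (simp add: homeomorphic_maps_def)
    from box_chart_not_metrizable[OF _ _ closed_manifold_path_connected[OF man] assms(3) U(1) chart this
        _ _ _ assms(4)] man n
    show ?thesis by (simp add: closed_manifold_def)
  next
    assume "X homeomorphic_space Hilbert_cube"
    then have HX: "Hilbert_cube homeomorphic_space X" by (rule iffD1[OF homeomorphic_space_sym])
    then obtain h where h: "homeomorphic_map Hilbert_cube X h" unfolding homeomorphic_space by blast
    have "compact_space Hilbert_cube"
      by (simp add: Hilbert_cube_def compact_space_product_topology compact_space_subtopology)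
    then have comp: "compact_space X" using HX homeomorphic_compact_space by blast
    have "Hausdorff_space Hilbert_cube"
      by (simp add: Hilbert_cube_def Hausdorff_space_product_topology Hausdorff_space_subtopology)
    then have Haus: "Hausdorff_space X" using HX homeomorphic_Hausdorff_space by blast
    have "path_connectedin euclideanreal {0..1}" by simp
    then have "path_connected_space Hilbert_cube"
      unfolding Hilbert_cube_def path_connected_space_product_topology path_connectedin_def by simp
    then have pc: "path_connected_space X" using HX homeomorphic_path_connected_space by blast
    \<comment> \<open>Only two coordinates are confined to the open interval, so the set is open in
      the product; there they can be stretched to lines.\<close>
    define V where "V = PiE UNIV (\<lambda>i::nat. if i \<in> {0, 1} then {0<..<1} else {0..1::real})"
    have V: "openin Hilbert_cube V"
    proof -
      have "{i::nat. (if i \<in> {0, 1} then {0<..<1} else {0..1::real}) \<noteq> topspace (top_of_set {0..1})} \<subseteq> {0, 1}"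
        by auto
      then have "finite {i \<in> UNIV::nat set. (if i \<in> {0, 1} then {0<..<1} else {0..1::real}) \<noteq> topspace (top_of_set {0..1})}"
        using finite_subset by fastforce
      moreover have "openin (top_of_set {0..1}) {0<..<1::real}"
        by (rule open_subset) auto
      ultimately show ?thesis
        unfolding Hilbert_cube_def V_def openin_PiE_gen by auto
    qed
    have "subtopology Hilbert_cube V
        = product_topology (\<lambda>i. subtopology (top_of_set {0..1}) (if i \<in> {0, 1} then {0<..<1} else {0..1})) UNIV"
      unfolding Hilbert_cube_def V_def by (rule subtopology_product_topology)
    also have "(\<lambda>i::nat. subtopology (top_of_set {0..1}) (if i \<in> {0, 1} then {0<..<1} else {0..1::real})) =
        (\<lambda>i. top_of_set (if i \<in> {0, 1} then {0<..<1} else {0..1}))"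
      by (auto simp: fun_eq_iff subtopology_subtopology intro!: arg_cong[of _ _ "subtopology euclidean"])
    finally have VQ: "subtopology Hilbert_cube V =
        product_topology (\<lambda>i. top_of_set (if i \<in> {0, 1} then {0<..<1} else {0..1})) UNIV" .
    have hV: "openin X (h ` V)" using homeomorphic_imp_open_map[OF h] V by (simp add: open_map_def)
    have VH: "V \<subseteq> topspace Hilbert_cube" using V by (rule openin_subset)
    have "homeomorphic_map (subtopology Hilbert_cube V) (subtopology X (h ` V)) h"
      using h VH hV openin_subset[OF hV]
      by (intro homeomorphic_map_subtopologies) (auto simp: Int_absorb1)
    then have chart: "product_topology (\<lambda>i::nat. top_of_set (if i \<in> {0, 1} then {0<..<1} else {0..1::real})) UNIV
        homeomorphic_space subtopology X (h ` V)"
      unfolding VQ by (rule homeomorphic_map_imp_homeomorphic_space)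
    \<comment> \<open>The open unit interval is the ball of radius \<open>1/2\<close> about
      \<open>1/2\<close>; this provides the stretching map.\<close>
    have "(UNIV :: real set) homeomorphic ball (1/2 :: real) (1/2)"
      by (rule iffD1[OF homeomorphic_sym homeomorphic_ball_UNIV]) simp
    then obtain s s' where "homeomorphism (UNIV :: real set) (ball (1/2 :: real) (1/2)) s s'"
      unfolding homeomorphic_def by blast
    moreover have "ball (1/2 :: real) (1/2) = {0<..<1}" by (simp add: ball_eq_greaterThanLessThan)
    ultimately have "homeomorphic_maps euclideanreal (top_of_set {0<..<1}) s s'"
      by (auto simp: homeomorphic_maps_def homeomorphism_def continuous_map_in_subtopology)
    from box_chart_not_metrizable[OF comp Haus pc assms(3) hV chart this _ _ _ assms(4)]
    show ?thesis by simp
  qed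
qed

end
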